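(* Let $H$ be a separable real Hilbert space and let $\{G_{s,t},\ 0\le s\le t<\infty\}$ be a semigroup of random finite-dimensional projections in $H$. Then there exist an orthonormal basis $\{e_k,\ k\ge 1\}$ of $H$ and Poisson processes $\{n_k,\ k\ge 1\}$ which have jointly independent increments, such that for all $0\le s\le t<\infty$ and all $u\in H$, with probability one, $$G_{s,t}(u)=\sum_{k=1}^{\infty}(u,e_k)\,\nu^{k}_{s,t}\,e_k,$$ where, for every $k\ge 1$ and $0\le s\le t$, $$\nu^{k}_{s,t}=\begin{cases}0, & n_k(t)-n_k(s)>0,\\ 1, & n_k(t)-n_k(s)=0.\end{cases}$$
   Context: $H$ is a separable real Hilbert space with inner product $(\cdot,\cdot)$, and $(\Omega,P)$ is the underlying probability space. $L_2(\Omega,P,H)$ denotes the space of square-integrable random elements in $H$. A strong random operator in $H$ is a continuous linear map from $H$ to $L_2(\Omega,P,H)$. A strong random operator $A$ is a bounded random operator if there is a family $\{A_\omega,\ \omega\in\Omega\}$ of deterministic bounded linear operators in $H$ such that for every $x\in H$, $(Ax)_\omega=A_\omega x$ almost surely. A bounded random operator is a random finite-dimensional projection if the family $\{A_\omega\}$ consists of orthogonal projections with finite-dimensional range. Products of bounded random operators are taken pointwise in $\omega$. A family of bounded random operators $\{G_{s,t},\ 0\le s\le t<\infty\}$ is a semigroup if: (1) for any $r\ge 0$ and $0\le s\le t$, $G_{s,t}$ and $G_{s+r,t+r}$ are equidistributed; (2) for any $x\in H$, $E\|G_{0,t}x-x\|^2\to 0$ as $t\to 0$; (3) for any $0\le s_1\le\cdots\le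 s_n<\infty$, the random operators $G_{s_1,s_2},\dots,G_{s_{n-1},s_n}$ are independent; (4) for any $r\le s\le t$, $G_{r,s}G_{s,t}=G_{r,t}$ and $G_{r,r}=I$, where $I$ is the identity operator (equalities hold almost surely). Here equidistribution and independence of random operators are understood for the $H$-valued random fields $x\mapsto G_{s,t}x$, $x\in H$. It is a semigroup of random finite-dimensional projections if, moreover, $G_{s,t}$ is a random finite-dimensional projection for all $0\le s<t$. The Poisson processes are homogeneous, started at $0$, with intensities $\lambda_k$ (the degenerate intensity $\lambda_k=0$, i.e. $n_k\equiv 0$, is allowed), defined on the same probability space. "Jointly independent increments" means that the vector-valued process $(n_k(t))_{k\ge1}$, $t\ge 0$, has independent increments over disjoint time intervals; the processes $n_k$ for different $k$ are not claimed to be independent of each other. If $H$ is finite-dimensional, the index $k$ runs over $1,\dots,\dim H$. *)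

theory Defs
  imports "HOL-Probability.Probability"
begin

text \<open>
  The separable real Hilbert space is a type of sort \<open>{real_inner, polish_space}\<close>: the class
  \<open>polish_space\<close> is completeness together with second countability, and the latter is separability
  for a metric space. Finite-dimensional spaces, including the zero space, are allowed.
\<close>

subsection \<open>Random operators\<close>

text \<open>
  An element of \<open>L\<^sub>2(\<Omega>, P, H)\<close> is given by a representative \<open>'w \<Rightarrow> 'h\<close>, and a map from \<open>H\<close> to
  \<open>L\<^sub>2(\<Omega>, P, H)\<close> by a function \<open>'h \<Rightarrow> 'w \<Rightarrow> 'h\<close>. As only the classes matter, linearity is required
  almost surely for each choice of arguments.
\<close>

definition square_integrable :: "'w measure \<Rightarrow> ('w \<Rightarrow> 'h::{real_inner, polish_space}) \<Rightarrow> bool"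
  where "square_integrable M X \<longleftrightarrow>
    X \<in> borel_measurable M \<and> integrable M (\<lambda>\<omega>. (norm (X \<omega>))\<^sup>2)"

definition strong_random_operator ::
  "'w measure \<Rightarrow> ('h::{real_inner, polish_space} \<Rightarrow> 'w \<Rightarrow> 'h) \<Rightarrow> bool"
  where "strong_random_operator M A \<longleftrightarrow>
    (\<forall>x. square_integrable M (A x)) \<and>
    (\<forall>x y. AE \<omega> in M. A (x + y) \<omega> = A x \<omega> + A y \<omega>) \<and>
    (\<forall>c x. AE \<omega> in M. A (c *\<^sub>R x) \<omega> = c *\<^sub>R A x \<omega>) \<and>
    (\<forall>x. ((\<lambda>y. \<integral>\<omega>. (norm (A y \<omega> - A x \<omega>))\<^sup>2 \<partial>M) \<longlongrightarrow> 0) (at x))"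

definition operator_family ::
  "'w measure \<Rightarrow> ('h::{real_inner, polish_space} \<Rightarrow> 'w \<Rightarrow> 'h) \<Rightarrow> ('w \<Rightarrow> 'h \<Rightarrow>\<^sub>L 'h) \<Rightarrow> bool"
  where "operator_family M A F \<longleftrightarrow> (\<forall>x. AE \<omega> in M. A x \<omega> = blinfun_apply (F \<omega>) x)"

definition bounded_random_operator ::
  "'w measure \<Rightarrow> ('h::{real_inner, polish_space} \<Rightarrow> 'w \<Rightarrow> 'h) \<Rightarrow> bool"
  where "bounded_random_operator M A \<longleftrightarrow>
    strong_random_operator M A \<and> (\<exists>F. operator_family M A F)"

definition random_operator_eq ::
  "'w measure \<Rightarrow> ('h::{real_inner, polish_space} \<Rightarrow> 'w \<Rightarrow> 'h) \<Rightarrow> ('h \<Rightarrow> 'w \<Rightarrow> 'h) \<Rightarrow> bool"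
  where "random_operator_eq M A B \<longleftrightarrow> (\<forall>x. AE \<omega> in M. A x \<omega> = B x \<omega>)"

text \<open>
  As \<open>H\<close> is separable, two families of bounded operators representing the same bounded random operator
  agree almost surely, so the pointwise product depends on the chosen families only up to a null set.
\<close>

definition the_family ::
  "'w measure \<Rightarrow> ('h::{real_inner, polish_space} \<Rightarrow> 'w \<Rightarrow> 'h) \<Rightarrow> 'w \<Rightarrow> 'h \<Rightarrow>\<^sub>L 'h"
  where "the_family M A = (SOME F. operator_family M A F)"

definition random_operator_prod ::
  "'w measure \<Rightarrow> ('h::{real_inner, polish_space} \<Rightarrow> 'w \<Rightarrow> 'h) \<Rightarrow> ('h \<Rightarrow> 'w \<Rightarrow> 'h) \<Rightarrow> 'h \<Rightarrow> 'w \<Rightarrow> 'h"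
  where "random_operator_prod M A B =
    (\<lambda>x \<omega>. blinfun_apply (the_family M A \<omega> o\<^sub>L the_family M B \<omega>) x)"

definition finite_dim :: "'h::real_vector set \<Rightarrow> bool"
  where "finite_dim S \<longleftrightarrow> (\<exists>B. finite B \<and> S = span B)"

definition orthogonal_projection :: "('h::real_inner \<Rightarrow> 'h) \<Rightarrow> bool"
  where "orthogonal_projection P \<longleftrightarrow>
    (\<exists>S. subspace S \<and> closed S \<and> (\<forall>x. P x \<in> S \<and> (\<forall>y\<in>S. orthogonal (x - P x) y)))"

definition random_finite_dim_projection ::
  "'w measure \<Rightarrow> ('h::{real_inner, polish_space} \<Rightarrow> 'w \<Rightarrow> 'h) \<Rightarrow> bool"
  where "random_finite_dim_projection M A \<longleftrightarrow>
    bounded_random_operator M A \<and>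
    (\<exists>F. operator_family M A F \<and>
      (\<forall>\<omega>\<in>space M. orthogonal_projection (blinfun_apply (F \<omega>)) \<and>
        finite_dim (range (blinfun_apply (F \<omega>)))))"


subsection \<open>Semigroups of random operators\<close>

text \<open>
  The random field \<open>x \<mapsto> A x\<close> is a random element of \<open>H\<^sup>H\<close> with the product \<open>\<sigma>\<close>-algebra; its law there
  is determined by the finite-dimensional distributions.
\<close>

definition field_space :: "('h::{real_inner, polish_space} \<Rightarrow> 'h) measure"
  where "field_space = (\<Pi>\<^sub>M x\<in>UNIV. borel)"

definition random_field :: "('h::{real_inner, polish_space} \<Rightarrow> 'w \<Rightarrow> 'h) \<Rightarrow> 'w \<Rightarrow> ('h \<Rightarrow> 'h)"
  where "random_field A = (\<lambda>\<omega> x. A x \<omega>)"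

definition equidistributed ::
  "'w measure \<Rightarrow> ('h::{real_inner, polish_space} \<Rightarrow> 'w \<Rightarrow> 'h) \<Rightarrow> ('h \<Rightarrow> 'w \<Rightarrow> 'h) \<Rightarrow> bool"
  where "equidistributed M A B \<longleftrightarrow>
    distr M field_space (random_field A) = distr M field_space (random_field B)"

text \<open>Values \<open>G s t\<close> outside \<open>0 \<le> s \<le> t\<close> are irrelevant junk.\<close>

definition random_operator_semigroup ::
  "'w measure \<Rightarrow> (real \<Rightarrow> real \<Rightarrow> 'h::{real_inner, polish_space} \<Rightarrow> 'w \<Rightarrow> 'h) \<Rightarrow> bool"
  where "random_operator_semigroup M G \<longleftrightarrow>
    (\<forall>s t. 0 \<le> s \<and> s \<le> t \<longrightarrow> bounded_random_operator M (G s t)) \<and>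
    (\<forall>r s t. 0 \<le> r \<and> 0 \<le> s \<and> s \<le> t \<longrightarrow> equidistributed M (G s t) (G (s + r) (t + r))) \<and>
    (\<forall>x. ((\<lambda>t. \<integral>\<omega>. (norm (G 0 t x \<omega> - x))\<^sup>2 \<partial>M) \<longlongrightarrow> 0) (at_right 0)) \<and>
    (\<forall>(m::nat) \<tau>. 0 \<le> \<tau> 0 \<and> (\<forall>i<m. \<tau> i \<le> \<tau> (Suc i)) \<longrightarrow>
      prob_space.indep_vars M (\<lambda>i. field_space)
        (\<lambda>i. random_field (G (\<tau> i) (\<tau> (Suc i)))) {..<m}) \<and>
    (\<forall>r s t. 0 \<le> r \<and> r \<le> s \<and> s \<le> t \<longrightarrow>
      random_operator_eq M (random_operator_prod M (G r s) (G s t)) (G r t)) \<and>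
    (\<forall>r\<ge>0. random_operator_eq M (G r r) (\<lambda>x \<omega>. x))"

definition finite_dim_projection_semigroup ::
  "'w measure \<Rightarrow> (real \<Rightarrow> real \<Rightarrow> 'h::{real_inner, polish_space} \<Rightarrow> 'w \<Rightarrow> 'h) \<Rightarrow> bool"
  where "finite_dim_projection_semigroup M G \<longleftrightarrow>
    random_operator_semigroup M G \<and>
    (\<forall>s t. 0 \<le> s \<and> s < t \<longrightarrow> random_finite_dim_projection M (G s t))"


subsection \<open>Orthonormal bases\<close>

definition basis_index :: "'h::real_vector set \<Rightarrow> nat set"
  where "basis_index V = (if finite_dim V then {1..dim V} else {1..})"

definition orthonormal_basis :: "nat set \<Rightarrow> (nat \<Rightarrow> 'h::real_inner) \<Rightarrow> bool"
  where "orthonormal_basis K e \<longleftrightarrow>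
    (\<forall>j\<in>K. \<forall>k\<in>K. inner (e j) (e k) = (if j = k then 1 else 0)) \<and>
    closure (span (e ` K)) = UNIV"


subsection \<open>Poisson processes\<close>

text \<open>
  Sample paths are \<open>nat\<close>-valued and nondecreasing, so for \<open>s \<le> t\<close> the truncated difference
  \<open>N t \<omega> - N s \<omega>\<close> is the true increment. Since \<open>0 ^ 0 = 1\<close>, rate \<open>0\<close> is the degenerate process that
  almost surely stays at \<open>0\<close>.
\<close>

definition poisson_process :: "'w measure \<Rightarrow> real \<Rightarrow> (real \<Rightarrow> 'w \<Rightarrow> nat) \<Rightarrow> bool"
  where "poisson_process M r N \<longleftrightarrow>
    0 \<le> r \<and>
    (\<forall>t\<ge>0. N t \<in> measurable M (count_space UNIV)) \<and>
    (\<forall>\<omega>\<in>space M. N 0 \<omega> = 0 \<and> mono_on {0..} (\<lambda>t. N t \<omega>) \<and>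
      (\<forall>t\<ge>0. continuous (at_right t) (\<lambda>u. N u \<omega>))) \<and>
    (\<forall>(m::nat) \<tau>. 0 \<le> \<tau> 0 \<and> (\<forall>i<m. \<tau> i \<le> \<tau> (Suc i)) \<longrightarrow>
      prob_space.indep_vars M (\<lambda>i. count_space UNIV)
        (\<lambda>i \<omega>. N (\<tau> (Suc i)) \<omega> - N (\<tau> i) \<omega>) {..<m}) \<and>
    (\<forall>s t j. 0 \<le> s \<and> s \<le> t \<longrightarrow>
      measure M {\<omega> \<in> space M. N t \<omega> - N s \<omega> = j} =
        (r * (t - s)) ^ j / fact j * exp (- (r * (t - s))))"

definition jointly_independent_increments ::
  "'w measure \<Rightarrow> nat set \<Rightarrow> (nat \<Rightarrow> real \<Rightarrow> 'w \<Rightarrow> nat) \<Rightarrow> bool"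
  where "jointly_independent_increments M K n \<longleftrightarrow>
    (\<forall>(m::nat) \<tau>. 0 \<le> \<tau> 0 \<and> (\<forall>i<m. \<tau> i \<le> \<tau> (Suc i)) \<longrightarrow>
      prob_space.indep_vars M (\<lambda>i. \<Pi>\<^sub>M k\<in>K. count_space UNIV)
        (\<lambda>i \<omega>. \<lambda>k\<in>K. n k (\<tau> (Suc i)) \<omega> - n k (\<tau> i) \<omega>) {..<m})"

definition no_jump :: "(real \<Rightarrow> 'w \<Rightarrow> nat) \<Rightarrow> real \<Rightarrow> real \<Rightarrow> 'w \<Rightarrow> real"
  where "no_jump N s t \<omega> = (if N t \<omega> - N s \<omega> > 0 then 0 else 1)"

end

theory Submission
  imports Defs "HOL-Real_Asymp.Real_Asymp"
begin

text \<open>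
  A product of two orthogonal projections that is itself a projection is a product of commuting projections.
  Since \<open>G\<^sub>0\<^sub>,\<^sub>s G\<^sub>s\<^sub>,\<^sub>s\<^sub>+\<^sub>t = G\<^sub>0\<^sub>,\<^sub>s\<^sub>+\<^sub>t\<close> with independent factors, realizations of \<open>G\<^sub>0\<^sub>,\<^sub>s\<close> and \<open>G\<^sub>0\<^sub>,\<^sub>t\<close> at independently
  chosen points commute almost surely, so the range of a typical realization is a deterministic
  finite-dimensional subspace invariant under all \<open>G\<^sub>0\<^sub>,\<^sub>t\<close>. On a minimal invariant subspace each \<open>G\<^sub>0\<^sub>,\<^sub>t\<close> is \<open>0\<close>
  or the identity; hence there is an orthonormal basis of vectors \<open>e\<close> with \<open>G\<^sub>s\<^sub>,\<^sub>t e \<in> {0, e}\<close> almost surely.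
  For such \<open>e\<close> the events \<open>G\<^sub>s\<^sub>,\<^sub>t e = 0\<close> behave like the presence of a jump in \<open>(s, t]\<close>: they are independent
  over disjoint intervals and have probability \<open>1 - exp (- \<lambda> (t - s))\<close>. Counting dyadic intervals with a jump
  and refining the grid yields a Poisson process, and the generating function of the binomial counts converges
  to that of the Poisson law.
\<close>

subsection \<open>Counting jumps along dyadic grids\<close>

text \<open>Every identity between the operators holds only off a null set that depends on the times
  and vectors involved, and no regularity of \<omega>-wise paths in t is given. The spectral part is
  therefore run over rational times and countable dense or finite sets of vectors: a single
  realization is fixed outside countably many null sets and then treated as a deterministic
  projection. General times return only for one eigenvector at a time, through stationarity and
  mean-square continuity. The same obstacle shapes the Poisson paths. They must start at 0, increase
  and be right-continuous at every \<omega>, so they are built deterministically from countably many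
  dyadic events, set to 0 where the grid is irregular, and only afterwards identified almost surely
  with the jumps between arbitrary real endpoints. Finite rank enters twice in the search for
  eigenvectors: a finite spanning set lets invariance vector by vector become invariance of the
  whole subspace for one \<omega>, and the dimension bounds the descent to smaller invariant
  subspaces.\<close>

definition dyadic_count :: "(nat \<Rightarrow> nat \<Rightarrow> bool) \<Rightarrow> nat \<Rightarrow> nat \<Rightarrow> nat"
  where "dyadic_count J m n = card {i\<in>{..<n}. J m i}"

definition dyadic_succ :: "nat \<Rightarrow> real \<Rightarrow> nat"
  where "dyadic_succ m t = nat \<lfloor>t * 2 ^ m\<rfloor> + 1"

text \<open>
  \<open>dyadic_succ m t / 2 ^ m\<close> is the least dyadic point of level \<open>m\<close> strictly beyond \<open>t\<close>; counting up to it and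
  letting \<open>m\<close> grow gives a right-continuous function of \<open>t\<close>.
\<close>

definition jump_count :: "(nat \<Rightarrow> nat \<Rightarrow> bool) \<Rightarrow> real \<Rightarrow> nat"
  where "jump_count J t =
    (LEAST n. \<exists>m. \<forall>j. dyadic_count J (m + j) (dyadic_succ m t * 2 ^ j) \<le> n)"

lemma dyadic_count_mono: "n \<le> n' \<Longrightarrow> dyadic_count J m n \<le> dyadic_count J m n'"
  unfolding dyadic_count_def by (intro card_mono) auto

lemma dyadic_count_Suc: "dyadic_count J m (Suc n) = dyadic_count J m n + of_bool (J m n)"
proof -
  have "{i\<in>{..<Suc n}. J m i} = {i\<in>{..<n}. J m i} \<union> (if J m n then {n} else {})"
    by (auto simp: less_Suc_eq)
  then show ?thesis
    unfolding dyadic_count_def by auto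
qed

lemma dyadic_count_diff:
  assumes "n \<le> n'"
  shows "dyadic_count J m n' - dyadic_count J m n = card {i\<in>{n..<n'}. J m i}"
proof -
  have "{i\<in>{..<n'}. J m i} = {i\<in>{..<n}. J m i} \<union> {i\<in>{n..<n'}. J m i}"
    using assms by auto
  moreover have "card \<dots> = card {i\<in>{..<n}. J m i} + card {i\<in>{n..<n'}. J m i}"
    by (intro card_Un_disjoint) auto
  ultimately show ?thesis
    unfolding dyadic_count_def by simp
qed

lemma dyadic_succ_gt: "t < real (dyadic_succ m t) / 2 ^ m"
proof -
  have "t * 2 ^ m < real (dyadic_succ m t)"
    unfolding dyadic_succ_def by linarith
  then show ?thesis by (simp add: field_simps)
qed

lemma dyadic_succ_le: "0 \<le> t \<Longrightarrow> real (dyadic_succ m t) / 2 ^ m \<le> t + 1 / 2 ^ m"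
proof -
  assume "0 \<le> t"
  then have "0 \<le> \<lfloor>t * 2 ^ m\<rfloor>" by simp
  then have "real (dyadic_succ m t) \<le> t * 2 ^ m + 1"
    unfolding dyadic_succ_def by linarith
  then show ?thesis by (simp add: field_simps)
qed

lemma dyadic_succ_mono: "s \<le> t \<Longrightarrow> dyadic_succ m s \<le> dyadic_succ m t"
  unfolding dyadic_succ_def by (intro add_mono nat_mono floor_mono mult_right_mono) auto

lemma dyadic_succ_refine: 
  assumes "0 \<le> t"
  shows "dyadic_succ (m + j) t \<le> dyadic_succ m t * 2 ^ j"
proof -
  have "t * 2 ^ m < real (dyadic_succ m t)"
    using dyadic_succ_gt[of t m] by (simp add: field_simps)
  then have "t * 2 ^ m * 2 ^ j < real (dyadic_succ m t) * 2 ^ j"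
    by simp
  then have "t * 2 ^ (m + j) < real (dyadic_succ m t * 2 ^ j)"
    by (simp add: power_add ac_simps)
  then have "\<lfloor>t * 2 ^ (m + j)\<rfloor> < int (dyadic_succ m t * 2 ^ j)"
    by linarith
  moreover have "0 \<le> \<lfloor>t * 2 ^ (m + j)\<rfloor>"
    using assms by simp
  ultimately show ?thesis
    unfolding dyadic_succ_def[of "m + j"] by (simp add: nat_less_iff Suc_le_eq del: of_nat_mult)
qed

text \<open>Halving a cell cannot lose its jump but may separate two jumps that shared it, so the
  count can only grow.\<close>

lemma dyadic_count_refine:
  assumes "\<And>i. J m i \<longleftrightarrow> J (Suc m) (2 * i) \<or> J (Suc m) (2 * i + 1)"
  shows "dyadic_count J m n \<le> dyadic_count J (Suc m) (2 * n)"
proof (induction n)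
  case (Suc n)
  have "dyadic_count J (Suc m) (2 * Suc n) =
      dyadic_count J (Suc m) (2 * n) + of_bool (J (Suc m) (2 * n)) + of_bool (J (Suc m) (2 * n + 1))"
    by (simp add: dyadic_count_Suc)
  then show ?case
    using Suc assms[of n] by (auto simp: dyadic_count_Suc)
qed (simp add: dyadic_count_def)

text \<open>The regularity of a single sample grid: the levels are consistent, the counts stabilize
  under refinement, and no jump sits immediately after time 0. Each condition is countable in
  nature, so the regular \<omega> form a measurable event.\<close>

locale dyadic_jumps =
  fixes J :: "nat \<Rightarrow> nat \<Rightarrow> bool"
  assumes split: "\<And>m i. J m i \<longleftrightarrow> J (Suc m) (2 * i) \<or> J (Suc m) (2 * i + 1)"
    and no_initial_jump: "\<exists>m. \<not> J m 0"
    and bounded_counts: "\<And>T. \<exists>K. \<forall>m. dyadic_count J m (T * 2 ^ m) \<le> K"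
begin

lemma count_refine:
  "i \<le> j \<Longrightarrow> dyadic_count J (m + i) (n * 2 ^ i) \<le> dyadic_count J (m + j) (n * 2 ^ j)"
proof (induction j rule: dec_induct)
  case (step k)
  show ?case
    using step.IH dyadic_count_refine[of J "m + k" "n * 2 ^ k", OF split] by (simp add: ac_simps)
qed simp

lemma count_bounded: "\<exists>K. \<forall>j. dyadic_count J (m + j) (n * 2 ^ j) \<le> K"
proof -
  obtain K where K: "\<And>m. dyadic_count J m (n * 2 ^ m) \<le> K"
    using bounded_counts by blast
  have "dyadic_count J (m + j) (n * 2 ^ j) \<le> K" for j
    using dyadic_count_mono[of "n * 2 ^ j" "n * 2 ^ (m + j)" J "m + j"] K[of "m + j"]
    by (auto simp: power_add)
  then show ?thesis by blast
qed

text \<open>A bounded nondecreasing sequence of natural numbers reaches its maximum and stays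
  there.\<close>

lemma counts_eventually:
  "\<exists>K j0. (\<forall>j\<ge>j0. dyadic_count J (m + j) (n * 2 ^ j) = K) \<and>
    (\<forall>j. dyadic_count J (m + j) (n * 2 ^ j) \<le> K)"
proof -
  let ?A = "range (\<lambda>j. dyadic_count J (m + j) (n * 2 ^ j))"
  have fin: "finite ?A"
    using count_bounded[of m n] by (metis (mono_tags, lifting) finite_nat_set_iff_bounded_le imageE)
  have "Max ?A \<in> ?A" using fin by (intro Max_in) auto
  then obtain j0 where j0: "Max ?A = dyadic_count J (m + j0) (n * 2 ^ j0)" by blast
  have le: "dyadic_count J (m + j) (n * 2 ^ j) \<le> Max ?A" for j
    using fin by (intro Max_ge) auto
  have "dyadic_count J (m + j) (n * 2 ^ j) = Max ?A" if "j \<ge> j0" for j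
    using le[of j] count_refine[OF that, of m n] j0 by simp
  then show ?thesis using le by blast
qed

text \<open>The number of jumps up to the dyadic point \<open>n / 2 ^ m\<close>, as the limit of the
  counts over all refinements; \<open>total_refine\<close> shows that it depends on the point
  only.\<close>

definition total :: "nat \<Rightarrow> nat \<Rightarrow> nat"
  where "total m n = (LEAST K. \<forall>j. dyadic_count J (m + j) (n * 2 ^ j) \<le> K)"

lemma total_upper: "dyadic_count J (m + j) (n * 2 ^ j) \<le> total m n"
  unfolding total_def using LeastI_ex[OF count_bounded[of m n]] by blast

lemma total_eventually: "\<exists>j0. \<forall>j\<ge>j0. dyadic_count J (m + j) (n * 2 ^ j) = total m n"
proof -
  obtain K j0 where K: "\<forall>j\<ge>j0. dyadic_count J (m + j) (n * 2 ^ j) = K"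
    "\<forall>j. dyadic_count J (m + j) (n * 2 ^ j) \<le> K"
    using counts_eventually by blast
  have "total m n = K"
    unfolding total_def
  proof (rule Least_equality)
    fix y assume "\<forall>j. dyadic_count J (m + j) (n * 2 ^ j) \<le> y"
    then show "K \<le> y" using K(1) by (metis le_refl)
  qed (use K in blast)
  then show ?thesis using K by blast
qed

lemma total_mono: assumes "n \<le> n'" shows "total m n \<le> total m n'"
proof -
  obtain j where "dyadic_count J (m + j) (n * 2 ^ j) = total m n"
    using total_eventually by blast
  then show ?thesis
    using dyadic_count_mono[of "n * 2 ^ j" "n' * 2 ^ j" J "m + j"] total_upper[of m j n'] assms
    by simp
qed

lemma total_refine: "total (m + i) (n * 2 ^ i) = total m n"
proof -
  obtain j0 where j0: "\<forall>j\<ge>j0. dyadic_count J (m + j) (n * 2 ^ j) = total m n"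
    using total_eventually by blast
  obtain j1 where j1: "\<forall>j\<ge>j1. dyadic_count J (m + i + j) (n * 2 ^ i * 2 ^ j) = total (m + i) (n * 2 ^ i)"
    using total_eventually by blast
  show ?thesis
    using j0[rule_format, of "i + (j0 + j1)"] j1[rule_format, of "j0 + j1"]
    by (simp add: power_add ac_simps)
qed

lemma total_less: assumes "n \<le> i" "i < n'" "J m i" shows "total m n < total m n'"
proof -
  obtain j where j: "dyadic_count J (m + j) (n * 2 ^ j) = total m n"
    using total_eventually by blast
  \<comment> \<open>A jump is inherited by at least one of the \<open>2 ^ j\<close> descendants of
    its cell.\<close>
  have *: "J m i \<Longrightarrow> \<exists>k. i * 2 ^ j \<le> k \<and> k < (i + 1) * 2 ^ j \<and> J (m + j) k" for i j
  proof (induction j)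
    case 0
    then show ?case by (intro exI[of _ i]) auto
  next
    case (Suc j)
    then obtain k where k: "i * 2 ^ j \<le> k" "k < (i + 1) * 2 ^ j" "J (m + j) k" by blast
    then have "J (Suc (m + j)) (2 * k) \<or> J (Suc (m + j)) (2 * k + 1)"
      using split by blast
    then show ?case
    proof
      assume "J (Suc (m + j)) (2 * k)"
      then show ?thesis using k by (intro exI[of _ "2 * k"]) auto
    next
      assume "J (Suc (m + j)) (2 * k + 1)"
      then show ?thesis using k by (intro exI[of _ "2 * k + 1"]) auto
    qed
  qed
  obtain k where k: "i * 2 ^ j \<le> k" "k < (i + 1) * 2 ^ j" "J (m + j) k"
    using *[OF assms(3)] by blast
  have "dyadic_count J (m + j) (n * 2 ^ j) \<le> dyadic_count J (m + j) k"
    using k(1) assms(1) by (intro dyadic_count_mono) (meson le_trans mult_le_mono1)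
  also have "\<dots> < dyadic_count J (m + j) (Suc k)"
    using k(3) by (simp add: dyadic_count_Suc)
  also have "Suc k \<le> n' * 2 ^ j"
    using k(2) assms(2) by (metis Suc_leI Suc_eq_plus1 le_trans mult_le_mono1)
  then have "dyadic_count J (m + j) (Suc k) \<le> dyadic_count J (m + j) (n' * 2 ^ j)"
    by (rule dyadic_count_mono)
  also have "\<dots> \<le> total m n'" by (rule total_upper)
  finally show ?thesis using j by simp
qed

text \<open>All descendants of a jump-free cell are jump-free, so the cell contributes nothing at
  any finer level.\<close>

lemma total_Suc_eq: "\<not> J m n \<Longrightarrow> total m (Suc n) = total m n"
proof -
  assume nJ: "\<not> J m n"
  have no: "\<not> J (m + j) k" if "n * 2 ^ j \<le> k" "k < Suc n * 2 ^ j" for j k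
    using that
  proof (induction j arbitrary: k)
    case 0
    then have "k = n" by simp
    then show ?case using nJ by simp
  next
    case (Suc j)
    have "n * 2 ^ j \<le> k div 2" "k div 2 < Suc n * 2 ^ j"
      using Suc.prems by auto
    then have "\<not> J (m + j) (k div 2)" by (rule Suc.IH)
    then have "\<not> J (Suc (m + j)) (2 * (k div 2))" "\<not> J (Suc (m + j)) (2 * (k div 2) + 1)"
      using split by blast+
    then show ?case by (metis add_Suc_right div_mult_mod_eq mult.commute mod_less_divisor[of 2] less_2_cases pos2 add_0_right One_nat_def)
  qed
  have "dyadic_count J (m + j) (Suc n * 2 ^ j) = dyadic_count J (m + j) (n * 2 ^ j)" for j
  proof -
    have "{i\<in>{..<Suc n * 2 ^ j}. J (m + j) i} = {i\<in>{..<n * 2 ^ j}. J (m + j) i}"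
      using no[of j] by (auto simp: not_less[symmetric]) 
    then show ?thesis unfolding dyadic_count_def by simp
  qed
  then show ?thesis unfolding total_def by simp
qed

text \<open>\<open>jump_count J t\<close> is the minimum over m of the totals at the dyadic points
  beyond t. Being a minimum of natural numbers it is attained at a level, and this level drives
  right continuity and stabilization.\<close>

lemma jump_count_attained: "\<exists>m. jump_count J t = total m (dyadic_succ m t)"
proof -
  let ?P = "\<lambda>n. \<exists>m. \<forall>j. dyadic_count J (m + j) (dyadic_succ m t * 2 ^ j) \<le> n"
  have "\<exists>n. ?P n" using count_bounded by blast
  then have "?P (jump_count J t)"
    unfolding jump_count_def by (rule LeastI_ex)
  then obtain m where m: "\<forall>j. dyadic_count J (m + j) (dyadic_succ m t * 2 ^ j) \<le> jump_count J t"
    by blast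
  then have "total m (dyadic_succ m t) \<le> jump_count J t"
    unfolding total_def by (rule Least_le)
  moreover have "jump_count J t \<le> total m (dyadic_succ m t)"
    unfolding jump_count_def by (rule Least_le) (use total_upper in blast)
  ultimately show ?thesis by (intro exI[of _ m]) simp
qed

lemma jump_count_le: "jump_count J t \<le> total m (dyadic_succ m t)"
  unfolding jump_count_def by (rule Least_le) (use total_upper in blast)

lemma jump_count_mono: assumes "s \<le> t" shows "jump_count J s \<le> jump_count J t"
  by (metis dyadic_succ_mono[OF assms] jump_count_attained jump_count_le le_trans total_mono)

lemma jump_count_0: "jump_count J 0 = 0"
proof -
  \<comment> \<open>\<open>dyadic_succ m 0\<close> is 1, so the count at time 0 does include the
    first cell; a level at which that cell is empty is needed.\<close>
  obtain m where "\<not> J m 0" using no_initial_jump by blast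
  then have "total m 1 = total m 0" using total_Suc_eq[of m 0] by simp
  also have "total m 0 = 0" unfolding total_def dyadic_count_def by simp
  finally show ?thesis using jump_count_le[of 0 m] by (simp add: dyadic_succ_def)
qed

text \<open>Take the level that attains the minimum at t. Until r reaches the dyadic point beyond t
  of that level, \<open>dyadic_succ m r\<close> is no larger, so the same total bounds the count at
  r.\<close>

lemma jump_count_right: 
  assumes "0 \<le> t"
  shows "eventually (\<lambda>r. jump_count J r = jump_count J t) (at_right t)"
proof -
  obtain m where m: "jump_count J t = total m (dyadic_succ m t)"
    using jump_count_attained by blast
  have "jump_count J r = jump_count J t" if "t < r" "r < real (dyadic_succ m t) / 2 ^ m" for r
  proof -
    have "r * 2 ^ m < real (dyadic_succ m t)"
      using that(2) by (simp add: field_simps)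
    then have "dyadic_succ m r \<le> dyadic_succ m t"
      using that assms unfolding dyadic_succ_def by linarith
    then have "jump_count J r \<le> jump_count J t"
      using jump_count_le[of r m] total_mono m by (metis le_trans)
    then show ?thesis using jump_count_mono[of t r] that by simp
  qed
  then show ?thesis
    unfolding eventually_at_right_field using dyadic_succ_gt by blast
qed

text \<open>Past the attaining level, finer levels drop some cells to the right of t. A jump in a
  dropped cell would make the total at the finer dyadic point strictly smaller than the
  minimum.\<close>

lemma jump_count_eventually:
  assumes "0 \<le> t"
  shows "eventually (\<lambda>m. dyadic_count J m (dyadic_succ m t) = jump_count J t) sequentially"
proof -
  obtain m0 where m0: "jump_count J t = total m0 (dyadic_succ m0 t)"
    using jump_count_attained by blast
  let ?n = "dyadic_succ m0 t"
  obtain j0 where j0: "\<forall>j\<ge>j0. dyadic_count J (m0 + j) (?n * 2 ^ j) = total m0 ?n"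
    using total_eventually by blast
  have "dyadic_count J (m0 + j) (dyadic_succ (m0 + j) t) = jump_count J t" if "j0 \<le> j" for j
  proof (rule ccontr)
    assume neq: "\<not> ?thesis"
    let ?k = "dyadic_succ (m0 + j) t"
    have le: "?k \<le> ?n * 2 ^ j" by (rule dyadic_succ_refine[OF assms])
    have "dyadic_count J (m0 + j) (?n * 2 ^ j) - dyadic_count J (m0 + j) ?k \<noteq> 0"
      using neq dyadic_count_mono[OF le, of J "m0 + j"] j0 that m0 by auto
    then have "{i\<in>{?k..<?n * 2 ^ j}. J (m0 + j) i} \<noteq> {}"
      unfolding dyadic_count_diff[OF le] by (metis card.empty)
    then obtain i where "?k \<le> i" "i < ?n * 2 ^ j" "J (m0 + j) i"
      by auto
    then have "total (m0 + j) ?k < total (m0 + j) (?n * 2 ^ j)"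
      by (rule total_less)
    then show False
      using jump_count_le[of t "m0 + j"] m0 by (simp add: total_refine)
  qed
  then show ?thesis
    unfolding eventually_sequentially
    by (intro exI[of _ "m0 + j0"]) (metis add_le_cancel_left le_add_diff_inverse le_trans le_add1)
qed

end


subsection \<open>Poisson limit of the counts\<close>

lemma measurable_card_Collect:
  assumes "finite I" and "\<And>i. i \<in> I \<Longrightarrow> Measurable.pred N (P i)"
  shows "(\<lambda>x. card {i\<in>I. P i x}) \<in> measurable N (count_space UNIV)"
  using assms
proof (induction I rule: finite_induct)
  case (insert j I)
  have [measurable]: "Measurable.pred N (P j)" "(\<lambda>x. card {i\<in>I. P i x}) \<in> measurable N (count_space UNIV)"
    using insert by auto
  have "{i \<in> insert j I. P i x} = (if P j x then insert j {i\<in>I. P i x} else {i\<in>I. P i x})" for x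
    by auto
  then have "(\<lambda>x. card {i \<in> insert j I. P i x}) =
      (\<lambda>x. if P j x then Suc (card {i\<in>I. P i x}) else card {i\<in>I. P i x})"
    using insert by (auto simp: fun_eq_iff)
  then show ?case by simp
qed simp

text \<open>Since \<open>ln (1 + x)\<close> differs from x by at most \<open>2 * x\<^sup>2\<close>,
  the exponents \<open>k * ln (1 + x)\<close> and \<open>k * x\<close> differ by at most
  \<open>2 * \<bar>k * x\<bar> * \<bar>x\<bar>\<close>, which vanishes.\<close>

lemma tendsto_one_plus_power:
  fixes x :: "nat \<Rightarrow> real" and k :: "nat \<Rightarrow> nat"
  assumes x: "x \<longlonglongrightarrow> 0" and kx: "(\<lambda>n. real (k n) * x n) \<longlonglongrightarrow> c"
  shows "(\<lambda>n. (1 + x n) ^ k n) \<longlonglongrightarrow> exp c"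
proof -
  \<comment> \<open>The range in which the quadratic bound on the logarithm is available.\<close>
  have small: "eventually (\<lambda>n. \<bar>x n\<bar> \<le> 1 / 2) sequentially"
  proof -
    have "eventually (\<lambda>n. \<bar>x n\<bar> < 1 / 2) sequentially"
      using tendsto_rabs_zero[OF x] by (rule order_tendstoD(2)) simp
    then show ?thesis by eventually_elim simp
  qed
  have "(\<lambda>n. real (k n) * ln (1 + x n) - real (k n) * x n) \<longlonglongrightarrow> 0"
  proof (rule Lim_null_comparison)
    show "eventually (\<lambda>n. norm (real (k n) * ln (1 + x n) - real (k n) * x n)
        \<le> 2 * \<bar>real (k n) * x n\<bar> * \<bar>x n\<bar>) sequentially"
      using small
    proof eventually_elim
      case (elim n)
      have "norm (real (k n) * ln (1 + x n) - real (k n) * x n) = real (k n) * \<bar>ln (1 + x n) - x n\<bar>"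
        by (simp add: abs_mult flip: right_diff_distrib)
      also have "\<dots> \<le> real (k n) * (2 * (x n)\<^sup>2)"
        by (intro mult_left_mono abs_ln_one_plus_x_minus_x_bound elim) simp
      finally show ?case
        by (simp add: abs_mult power2_eq_square ac_simps)
    qed
    have "(\<lambda>n. 2 * \<bar>real (k n) * x n\<bar> * \<bar>x n\<bar>) \<longlonglongrightarrow> 2 * \<bar>c\<bar> * \<bar>0\<bar>"
      by (intro tendsto_intros kx x)
    then show "(\<lambda>n. 2 * \<bar>real (k n) * x n\<bar> * \<bar>x n\<bar>) \<longlonglongrightarrow> 0" by simp
  qed
  from tendsto_add[OF this kx] have "(\<lambda>n. real (k n) * ln (1 + x n)) \<longlonglongrightarrow> c"
    by simp
  then have "(\<lambda>n. exp (real (k n) * ln (1 + x n))) \<longlonglongrightarrow> exp c"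
    by (rule tendsto_exp)
  moreover have "eventually (\<lambda>n. exp (real (k n) * ln (1 + x n)) = (1 + x n) ^ k n) sequentially"
    using small by eventually_elim (simp add: exp_of_nat_mult)
  ultimately show ?thesis
    by (rule Lim_transform_eventually)
qed

text \<open>Once the coefficients below n agree, the difference of the series divided by
  \<open>z ^ n\<close> is 0 off the origin, and its limit at 0 is the difference of the coefficients
  at n.\<close>

lemma power_series_unique:
  fixes a b :: "nat \<Rightarrow> real"
  assumes "\<And>z. \<bar>z\<bar> < 1 \<Longrightarrow> (\<lambda>n. a n * z ^ n) sums f z"
    and "\<And>z. \<bar>z\<bar> < 1 \<Longrightarrow> (\<lambda>n. b n * z ^ n) sums f z"
  shows "a n = b n"
proof (induction n rule: less_induct)
  case (less n)
  have "((\<lambda>_::real. 0::real) \<longlongrightarrow> a (0 + n) - b (0 + n)) (at 0)"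
  proof (rule powser_limit_0_strong[of 1 "\<lambda>j. a (j + n) - b (j + n)" "\<lambda>_. 0"])
    fix z :: real assume z: "z \<noteq> 0" "norm z < 1"
    have "(\<lambda>j. a j * z ^ j - b j * z ^ j) sums (f z - f z)"
      using z by (intro sums_diff assms) auto
    then have "(\<lambda>j. a (j + n) * z ^ (j + n) - b (j + n) * z ^ (j + n)) sums
        (f z - f z - (\<Sum>j<n. a j * z ^ j - b j * z ^ j))"
      by (rule sums_split_initial_segment)
    moreover have "(\<Sum>j<n. a j * z ^ j - b j * z ^ j) = 0"
      using less by (intro sum.neutral) auto
    ultimately have "(\<lambda>j. a (j + n) * z ^ (j + n) - b (j + n) * z ^ (j + n)) sums 0"
      by simp
    from sums_mult2[OF this, of "inverse (z ^ n)"]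
    show "(\<lambda>j. (a (j + n) - b (j + n)) * z ^ j) sums 0"
      using z by (simp add: power_add left_diff_distrib mult.assoc)
  qed simp
  then show ?case
    by (simp add: tendsto_const_iff)
qed

text \<open>Expanding \<open>z ^ X\<close> over the values of X and integrating termwise, with the
  geometric bound \<open>\<bar>z\<bar> ^ j\<close>, makes the point probabilities the coefficients
  of the generating function; they are compared with those of
  \<open>exp (- c) * exp (c * z)\<close>.\<close>

lemma (in prob_space) poisson_law_of_pgf:
  fixes X :: "'a \<Rightarrow> nat"
  assumes X[measurable]: "X \<in> measurable M (count_space UNIV)"
    and pgf: "\<And>z::real. \<bar>z\<bar> < 1 \<Longrightarrow> (\<integral>\<omega>. z ^ X \<omega> \<partial>M) = exp (c * (z - 1))"
  shows "prob {\<omega>\<in>space M. X \<omega> = j} = c ^ j / fact j * exp (- c)"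
proof (rule power_series_unique)
  fix z :: real assume z: "\<bar>z\<bar> < 1"
  let ?f = "\<lambda>j \<omega>. indicator {\<omega>\<in>space M. X \<omega> = j} \<omega> * z ^ j"
  have int: "integrable M (?f j)" for j
    by (intro integrable_mult_left integrable_real_indicator) (auto simp: emeasure_eq_measure)
  have sums: "(\<lambda>j. ?f j \<omega>) sums z ^ X \<omega>" if "\<omega> \<in> space M" for \<omega>
  proof -
    have "(\<lambda>j. ?f j \<omega>) = (\<lambda>j. if j = X \<omega> then z ^ j else 0)"
      using that by (auto simp: indicator_def fun_eq_iff)
    then show ?thesis using sums_single[of "X \<omega>" "\<lambda>j. z ^ j"] that by simp
  qed
  have "(\<lambda>j. integral\<^sup>L M (?f j)) sums (\<integral>\<omega>. (\<Sum>j. ?f j \<omega>) \<partial>M)"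
  proof (rule sums_integral)
    show "AE \<omega> in M. summable (\<lambda>j. norm (?f j \<omega>))"
    proof (rule AE_I2)
      fix \<omega>
      have "(\<lambda>j. norm (?f j \<omega>)) = (\<lambda>j. if j = X \<omega> then norm (?f (X \<omega>) \<omega>) else 0)"
        by (auto simp: indicator_def fun_eq_iff)
      then show "summable (\<lambda>j. norm (?f j \<omega>))" using summable_single by simp
    qed
    show "summable (\<lambda>j. \<integral>\<omega>. norm (?f j \<omega>) \<partial>M)"
    proof (rule summable_comparison_test')
      show "summable (\<lambda>j. \<bar>z\<bar> ^ j)" using z by (intro summable_geometric) simp
      fix j :: nat
      have "(\<integral>\<omega>. norm (?f j \<omega>) \<partial>M) \<le> (\<integral>\<omega>. \<bar>z\<bar> ^ j \<partial>M)"
        by (intro integral_mono integrable_norm int) (auto simp: indicator_def abs_mult power_abs)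
      moreover have "0 \<le> (\<integral>\<omega>. norm (?f j \<omega>) \<partial>M)"
        by (intro integral_nonneg_AE) auto
      ultimately show "norm (\<integral>\<omega>. norm (?f j \<omega>) \<partial>M) \<le> \<bar>z\<bar> ^ j"
        by (simp add: prob_space)
    qed
  qed (rule int)
  also have "(\<integral>\<omega>. (\<Sum>j. ?f j \<omega>) \<partial>M) = (\<integral>\<omega>. z ^ X \<omega> \<partial>M)"
    using sums by (intro Bochner_Integration.integral_cong refl sums_unique[symmetric]) auto
  finally show "(\<lambda>j. prob {\<omega>\<in>space M. X \<omega> = j} * z ^ j) sums exp (c * (z - 1))"
    by (simp add: pgf[OF z])
  have "(\<lambda>j. exp (- c) * ((c * z) ^ j /\<^sub>R fact j)) sums (exp (- c) * exp (c * z))"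
    by (intro sums_mult exp_converges)
  then show "(\<lambda>j. c ^ j / fact j * exp (- c) * z ^ j) sums exp (c * (z - 1))"
    by (simp add: exp_add[symmetric] algebra_simps power_mult_distrib divide_inverse)
qed

lemma tendsto_dyadic_succ:
  assumes "0 \<le> t"
  shows "(\<lambda>m. real (dyadic_succ m t) / 2 ^ m) \<longlonglongrightarrow> t"
proof (rule tendsto_sandwich[of "\<lambda>_. t" _ _ "\<lambda>m. t + 1 / 2 ^ m"])
  show "(\<lambda>m. t + 1 / 2 ^ m) \<longlonglongrightarrow> t" by real_asymp
qed (use assms dyadic_succ_gt[of t] dyadic_succ_le in \<open>auto simp: less_imp_le\<close>)

section \<open>Random grids and the counting process they define\<close>

definition grid :: "(real \<Rightarrow> real \<Rightarrow> 'w \<Rightarrow> bool) \<Rightarrow> 'w \<Rightarrow> nat \<Rightarrow> nat \<Rightarrow> bool"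
  where "grid J \<omega> m i = J (real i / 2 ^ m) (real (i + 1) / 2 ^ m) \<omega>"

text \<open>The default 0 on irregular grids gives the required path properties at every \<omega>,
  not just almost surely.\<close>

definition counting_process :: "(real \<Rightarrow> real \<Rightarrow> 'w \<Rightarrow> bool) \<Rightarrow> real \<Rightarrow> 'w \<Rightarrow> nat"
  where "counting_process J t \<omega> = (if dyadic_jumps (grid J \<omega>) then jump_count (grid J \<omega>) t else 0)"

text \<open>\<open>J s t\<close> plays the role of "some jump occurs in (s, t]". Independence is
  asked for along each dyadic grid only, as the counts read nothing else.\<close>

locale jump_family = prob_space M for M :: "'w measure" +
  fixes J :: "real \<Rightarrow> real \<Rightarrow> 'w \<Rightarrow> bool" and r :: real
  assumes r_nonneg: "0 \<le> r"
    and J_measurable: "\<And>s t. 0 \<le> s \<Longrightarrow> s \<le> t \<Longrightarrow> Measurable.pred M (J s t)"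
    and J_split: "\<And>s t u. 0 \<le> s \<Longrightarrow> s \<le> t \<Longrightarrow> t \<le> u \<Longrightarrow> AE \<omega> in M. J s u \<omega> \<longleftrightarrow> J s t \<omega> \<or> J t u \<omega>"
    and J_prob: "\<And>s t. 0 \<le> s \<Longrightarrow> s \<le> t \<Longrightarrow> prob {\<omega>\<in>space M. J s t \<omega>} = 1 - exp (- (r * (t - s)))"
    and J_indep: "\<And>m n. indep_vars (\<lambda>_. count_space UNIV) (\<lambda>i \<omega>. grid J \<omega> m i) {..<n}"
begin

abbreviation N where "N \<equiv> counting_process J"

lemma grid_measurable[measurable]: "Measurable.pred M (\<lambda>\<omega>. grid J \<omega> m i)"
  unfolding grid_def by (rule J_measurable) (auto simp: field_simps)

lemma prob_grid: "prob {\<omega>\<in>space M. grid J \<omega> m i} = 1 - exp (- (r / 2 ^ m))"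
  unfolding grid_def by (subst J_prob) (auto simp: field_simps)

lemma dyadic_count_measurable[measurable]:
  "(\<lambda>\<omega>. dyadic_count (grid J \<omega>) m n) \<in> measurable M (count_space UNIV)"
  unfolding dyadic_count_def by (intro measurable_card_Collect) auto

lemma regular_measurable[measurable]: "Measurable.pred M (\<lambda>\<omega>. dyadic_jumps (grid J \<omega>))"
  unfolding dyadic_jumps_def by measurable

lemma jump_count_measurable[measurable]:
  "(\<lambda>\<omega>. jump_count (grid J \<omega>) t) \<in> measurable M (count_space UNIV)"
  unfolding jump_count_def by measurable

lemma N_measurable[measurable]: "N t \<in> measurable M (count_space UNIV)"
  unfolding counting_process_def by measurable

lemma one_minus_exp_le: "1 - exp (- x) \<le> (x::real)"
  using exp_ge_add_one_self[of "- x"] by linarith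

lemma grid_split: "AE \<omega> in M. \<forall>m i. grid J \<omega> m i \<longleftrightarrow> grid J \<omega> (Suc m) (2 * i) \<or> grid J \<omega> (Suc m) (2 * i + 1)"
proof -
  have "AE \<omega> in M. grid J \<omega> m i \<longleftrightarrow> grid J \<omega> (Suc m) (2 * i) \<or> grid J \<omega> (Suc m) (2 * i + 1)" for m i
  proof -
    have "real (2 * i) / 2 ^ Suc m = real i / 2 ^ m" "real (2 * i + 1 + 1) / 2 ^ Suc m = real (i + 1) / 2 ^ m"
      by (simp_all add: field_simps)
    then show ?thesis
      using J_split[of "real i / 2 ^ m" "real (2 * i + 1) / 2 ^ Suc m" "real (i + 1) / 2 ^ m"]
      unfolding grid_def by (simp only:) (simp add: divide_right_mono field_simps)
  qed
  then show ?thesis by (simp add: AE_all_countable)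
qed

text \<open>An initial jump at all levels has probability at most
  \<open>1 - exp (- (r / 2 ^ m))\<close> for every m. For boundedness,
  \<open>1 - exp (- x) \<le> x\<close> bounds the mean count up to T by \<open>T * r\<close> at
  every level, and monotone convergence bounds the mean of the supremum, which is thus finite almost
  surely.\<close>

lemma AE_regular: "AE \<omega> in M. dyadic_jumps (grid J \<omega>)"
proof -
  have init: "AE \<omega> in M. \<exists>m. \<not> grid J \<omega> m 0"
  proof -
    have "prob {\<omega>\<in>space M. \<forall>m. grid J \<omega> m 0} \<le> 1 - exp (- (r / 2 ^ m))" for m
      unfolding prob_grid[of m 0, symmetric] by (intro finite_measure_mono) auto
    moreover have "(\<lambda>m. 1 - exp (- (r / 2 ^ m))) \<longlonglongrightarrow> 1 - exp (- (r * 0))"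
      by (intro tendsto_intros) real_asymp
    ultimately have "prob {\<omega>\<in>space M. \<forall>m. grid J \<omega> m 0} \<le> 0"
      by (intro LIMSEQ_le_const) (auto simp: eventually_sequentially)
    then have "prob {\<omega>\<in>space M. \<forall>m. grid J \<omega> m 0} = 0"
      by (simp add: measure_le_0_iff)
    then show ?thesis
      by (subst AE_iff_measurable[OF _ refl]) (auto simp: emeasure_eq_measure)
  qed
  have bdd: "AE \<omega> in M. \<exists>K. \<forall>m. dyadic_count (grid J \<omega>) m (T * 2 ^ m) \<le> K" for T
  proof -
    let ?f = "\<lambda>m \<omega>. ennreal (real (dyadic_count (grid J \<omega>) m (T * 2 ^ m)))"
    have int: "(\<integral>\<^sup>+\<omega>. ?f m \<omega> \<partial>M) \<le> ennreal (real T * r)" for m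
    proof -
      have eq: "real (dyadic_count (grid J \<omega>) m n) = (\<Sum>i<n. indicator {\<omega>\<in>space M. grid J \<omega> m i} \<omega>)"
        if "\<omega> \<in> space M" for \<omega> n
        by (induction n) (auto simp: dyadic_count_Suc that dyadic_count_def[of _ _ 0])
      have "(\<integral>\<^sup>+\<omega>. ?f m \<omega> \<partial>M) = (\<integral>\<^sup>+\<omega>. (\<Sum>i<T * 2 ^ m. indicator {\<omega>\<in>space M. grid J \<omega> m i} \<omega>) \<partial>M)"
        by (intro nn_integral_cong) (simp add: eq sum_ennreal[symmetric] ennreal_indicator)
      also have "\<dots> = (\<Sum>i<T * 2 ^ m. emeasure M {\<omega>\<in>space M. grid J \<omega> m i})"
        by (subst nn_integral_sum) auto
      also have "\<dots> = (\<Sum>i<T * 2 ^ m. ennreal (1 - exp (- (r / 2 ^ m))))"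
        by (simp add: emeasure_eq_measure prob_grid)
      also have "\<dots> = ennreal (\<Sum>i<T * 2 ^ m. 1 - exp (- (r / 2 ^ m)))"
        using r_nonneg by (intro sum_ennreal) auto
      also have "\<dots> \<le> ennreal (\<Sum>i<T * 2 ^ m. r / 2 ^ m)"
        by (intro ennreal_leI sum_mono one_minus_exp_le)
      also have "\<dots> = ennreal (real T * r)"
        by simp
      finally show ?thesis .
    qed
    have "(\<integral>\<^sup>+\<omega>. (SUP m. ?f m \<omega>) \<partial>M) = (SUP m. \<integral>\<^sup>+\<omega>. ?f m \<omega> \<partial>M)"
    proof (rule nn_integral_monotone_convergence_SUP_AE)
      fix m
      show "AE \<omega> in M. ?f m \<omega> \<le> ?f (Suc m) \<omega>"
        using grid_split
      proof eventually_elim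
        case (elim \<omega>)
        have "dyadic_count (grid J \<omega>) m (T * 2 ^ m) \<le> dyadic_count (grid J \<omega>) (Suc m) (2 * (T * 2 ^ m))"
          by (rule dyadic_count_refine) (use elim in blast)
        then show ?case
          by (auto intro!: ennreal_leI simp: ac_simps)
      qed
    qed measurable
    also have "\<dots> \<le> ennreal (real T * r)"
      by (intro SUP_least int)
    finally have "(\<integral>\<^sup>+\<omega>. (SUP m. ?f m \<omega>) \<partial>M) \<noteq> \<infinity>"
      by (auto simp: top_unique)
    then have "AE \<omega> in M. (SUP m. ?f m \<omega>) \<noteq> \<infinity>"
      by (intro nn_integral_PInf_AE) measurable
    then show ?thesis
    proof eventually_elim
      case (elim \<omega>)
      then obtain c where c: "(SUP m. ?f m \<omega>) = ennreal c" "0 \<le> c"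
        by (cases "SUP m. ?f m \<omega>") auto
      have "dyadic_count (grid J \<omega>) m (T * 2 ^ m) \<le> nat \<lceil>c\<rceil>" for m
      proof -
        have "?f m \<omega> \<le> ennreal c" unfolding c(1)[symmetric] by (rule SUP_upper) simp
        then have "real (dyadic_count (grid J \<omega>) m (T * 2 ^ m)) \<le> c" using c(2) by simp
        then show ?thesis by linarith
      qed
      then show ?case by blast
    qed
  qed
  have "AE \<omega> in M. \<forall>T. \<exists>K. \<forall>m. dyadic_count (grid J \<omega>) m (T * 2 ^ m) \<le> K"
    using bdd by (simp add: AE_all_countable)
  with init grid_split show ?thesis
  proof eventually_elim
    case (elim \<omega>)
    show ?case
      by (rule dyadic_jumps.intro) (rule elim(2)[rule_format] elim(1) elim(3)[rule_format])+
  qed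
qed

lemma N_0: "N 0 \<omega> = 0"
  unfolding counting_process_def using dyadic_jumps.jump_count_0 by auto

lemma N_mono: "mono_on {0..} (\<lambda>t. N t \<omega>)"
  unfolding counting_process_def
  by (intro mono_onI) (auto intro: dyadic_jumps.jump_count_mono)

lemma N_right_continuous: "0 \<le> t \<Longrightarrow> continuous (at_right t) (\<lambda>u. N u \<omega>)"
proof -
  assume t: "0 \<le> t"
  have "eventually (\<lambda>u. N u \<omega> = N t \<omega>) (at_right t)"
    using dyadic_jumps.jump_count_right[of "grid J \<omega>" t] t
    unfolding counting_process_def by auto
  then show ?thesis
    unfolding continuous_within by (rule tendsto_eventually)
qed

lemma AE_count_eventually:
  assumes "0 \<le> t"
  shows "AE \<omega> in M. eventually (\<lambda>m. dyadic_count (grid J \<omega>) m (dyadic_succ m t) = N t \<omega>) sequentially"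
  using AE_regular
  by eventually_elim (simp add: counting_process_def dyadic_jumps.jump_count_eventually assms)

lemma AE_increment_eventually:
  assumes "0 \<le> s" "s \<le> t"
  shows "AE \<omega> in M. eventually (\<lambda>m. card {i\<in>{dyadic_succ m s..<dyadic_succ m t}. grid J \<omega> m i}
    = N t \<omega> - N s \<omega>) sequentially"
  using AE_count_eventually[OF assms(1)] AE_count_eventually[OF order_trans[OF assms]]
proof eventually_elim
  case (elim \<omega>)
  show ?case
    using elim by eventually_elim
      (simp only: dyadic_count_diff[OF dyadic_succ_mono[OF assms(2)], symmetric])
qed

text \<open>z to the count is a product over the cells of independent factors, z on a jump and 1
  otherwise: this is the generating function of a binomial law.\<close>

lemma pgf_block:
  fixes z :: real
  assumes "finite I"
  shows "(\<integral>\<omega>. z ^ card {i\<in>I. grid J \<omega> m i} \<partial>M) = (1 + (z - 1) * (1 - exp (- (r / 2 ^ m)))) ^ card I"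
proof -
  let ?Z = "\<lambda>i \<omega>. if grid J \<omega> m i then z else 1"
  obtain n where n: "I \<subseteq> {..<n}"
    using finite_nat_iff_bounded assms by blast
  have eq: "z ^ card {i\<in>I. grid J \<omega> m i} = (\<Prod>i\<in>I. ?Z i \<omega>)" for \<omega>
  proof -
    have "(\<Prod>i\<in>I. ?Z i \<omega>) = (\<Prod>i\<in>{i\<in>I. grid J \<omega> m i}. z)"
      using assms by (intro prod.mono_neutral_cong_right) auto
    then show ?thesis by simp
  qed
  have Z: "integrable M (?Z i)" for i
    by (intro integrable_const_bound[where B="max 1 \<bar>z\<bar>"]) auto
  have EZ: "(\<integral>\<omega>. ?Z i \<omega> \<partial>M) = 1 + (z - 1) * (1 - exp (- (r / 2 ^ m)))" for i
  proof -
    have "(\<integral>\<omega>. ?Z i \<omega> \<partial>M) = (\<integral>\<omega>. 1 + (z - 1) * indicator {\<omega>\<in>space M. grid J \<omega> m i} \<omega> \<partial>M)"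
      by (intro Bochner_Integration.integral_cong) auto
    also have "\<dots> = 1 + (z - 1) * prob {\<omega>\<in>space M. grid J \<omega> m i}"
      by (subst Bochner_Integration.integral_add) (auto simp: prob_space emeasure_eq_measure)
    finally show ?thesis by (simp add: prob_grid)
  qed
  have "(\<integral>\<omega>. (\<Prod>i\<in>I. ?Z i \<omega>) \<partial>M) = (\<Prod>i\<in>I. \<integral>\<omega>. ?Z i \<omega> \<partial>M)"
    using assms Z
  proof (intro indep_vars_lebesgue_integral)
    show "indep_vars (\<lambda>_. borel) ?Z I"
      by (rule indep_vars_compose2[OF indep_vars_subset[OF J_indep n], of "\<lambda>_ b. if b then z else 1"]) simp
  qed auto
  then show ?thesis
    by (simp only: eq EZ prod_constant)
qed

lemma increment_law:
  assumes st: "0 \<le> s" "s \<le> t"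
  shows "prob {\<omega>\<in>space M. N t \<omega> - N s \<omega> = j} = (r * (t - s)) ^ j / fact j * exp (- (r * (t - s)))"
proof (rule poisson_law_of_pgf)
  fix z :: real assume z: "\<bar>z\<bar> < 1"
  let ?D = "\<lambda>m \<omega>. card {i\<in>{dyadic_succ m s..<dyadic_succ m t}. grid J \<omega> m i}"
  let ?x = "\<lambda>m::nat. (z - 1) * (1 - exp (- (r / 2 ^ m)))"
  have [measurable]: "(\<lambda>\<omega>. ?D m \<omega>) \<in> measurable M (count_space UNIV)" for m
    by (intro measurable_card_Collect) auto
  have "(\<lambda>m. \<integral>\<omega>. z ^ ?D m \<omega> \<partial>M) \<longlonglongrightarrow> (\<integral>\<omega>. z ^ (N t \<omega> - N s \<omega>) \<partial>M)"
  proof (rule integral_dominated_convergence[where w="\<lambda>_. 1"])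
    show "AE \<omega> in M. (\<lambda>m. z ^ ?D m \<omega>) \<longlonglongrightarrow> z ^ (N t \<omega> - N s \<omega>)"
      using AE_increment_eventually[OF st]
      by eventually_elim (auto intro!: tendsto_eventually elim: eventually_mono)
    show "AE \<omega> in M. norm (z ^ ?D m \<omega>) \<le> 1" for m
      using z by (auto simp: power_abs intro!: power_le_one)
  qed auto
  moreover have "(\<lambda>m. \<integral>\<omega>. z ^ ?D m \<omega> \<partial>M) \<longlonglongrightarrow> exp (r * (t - s) * (z - 1))"
    unfolding pgf_block[OF finite_atLeastLessThan]
  proof (rule tendsto_one_plus_power)
    have "(\<lambda>m::nat. r / 2 ^ m) \<longlonglongrightarrow> 0" by real_asymp
    then have "?x \<longlonglongrightarrow> (z - 1) * (1 - exp (- 0))" by (intro tendsto_intros)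
    then show "?x \<longlonglongrightarrow> 0" by simp
    \<comment> \<open>The powers \<open>2 ^ m\<close> are split so that both factors converge: the
      number of cells times the mesh tends to \<open>t - s\<close>, and the jump probability of a
      cell divided by the mesh tends to r.\<close>
    have "(\<lambda>m::nat. 2 ^ m * (1 - exp (- (r / 2 ^ m)))) \<longlonglongrightarrow> r"
      by real_asymp
    moreover have "(\<lambda>m. real (dyadic_succ m t) / 2 ^ m - real (dyadic_succ m s) / 2 ^ m) \<longlonglongrightarrow> t - s"
      using st by (intro tendsto_intros tendsto_dyadic_succ) auto
    ultimately have "(\<lambda>m. (real (dyadic_succ m t) / 2 ^ m - real (dyadic_succ m s) / 2 ^ m) * (z - 1) *
        (2 ^ m * (1 - exp (- (r / 2 ^ m))))) \<longlonglongrightarrow> (t - s) * (z - 1) * r"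
      by (intro tendsto_mult tendsto_const)
    moreover have "real (card {dyadic_succ m s..<dyadic_succ m t}) * ?x m =
      (real (dyadic_succ m t) / 2 ^ m - real (dyadic_succ m s) / 2 ^ m) * (z - 1) *
        (2 ^ m * (1 - exp (- (r / 2 ^ m))))" for m
      using dyadic_succ_mono[OF st(2), of m] by (simp add: of_nat_diff flip: diff_divide_distrib)
    moreover have "(t - s) * (z - 1) * r = r * (t - s) * (z - 1)" by simp
    ultimately show "(\<lambda>m. real (card {dyadic_succ m s..<dyadic_succ m t}) * ?x m) \<longlonglongrightarrow> r * (t - s) * (z - 1)"
      by (simp only:)
  qed
  ultimately show "(\<integral>\<omega>. z ^ (N t \<omega> - N s \<omega>) \<partial>M) = exp (r * (t - s) * (z - 1))"
    by (rule LIMSEQ_unique)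
qed measurable

text \<open>Splitting is iterated over adjacent cells. The empty block is not given by splitting:
  there \<open>J\<close> has coinciding endpoints and hence probability 0.\<close>

lemma AE_block:
  assumes "n \<le> n'"
  shows "AE \<omega> in M. J (real n / 2 ^ m) (real n' / 2 ^ m) \<omega> \<longleftrightarrow> (\<exists>i\<in>{n..<n'}. grid J \<omega> m i)"
  using assms
proof (induction n' rule: dec_induct)
  case base
  have "prob {\<omega>\<in>space M. J (real n / 2 ^ m) (real n / 2 ^ m) \<omega>} = 0"
    by (subst J_prob) auto
  moreover have "Measurable.pred M (J (real n / 2 ^ m) (real n / 2 ^ m))"
    by (rule J_measurable) auto
  ultimately have "AE \<omega> in M. \<not> J (real n / 2 ^ m) (real n / 2 ^ m) \<omega>"
    by (subst AE_iff_measurable[OF _ refl]) (auto simp: emeasure_eq_measure)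
  then show ?case by simp
next
  case (step k)
  have "AE \<omega> in M. J (real n / 2 ^ m) (real (Suc k) / 2 ^ m) \<omega> \<longleftrightarrow>
      J (real n / 2 ^ m) (real k / 2 ^ m) \<omega> \<or> J (real k / 2 ^ m) (real (Suc k) / 2 ^ m) \<omega>"
    using step by (intro J_split) (auto simp: field_simps)
  with step.IH show ?case
  proof eventually_elim
    case (elim \<omega>)
    have "{n..<Suc k} = insert k {n..<k}" using step.hyps by auto
    then show ?case using elim by (auto simp: grid_def)
  qed
qed

text \<open>Jumps between t and the next dyadic point of level m have probability at most
  \<open>r / 2 ^ m\<close>, which is summable, so Borel-Cantelli applies. This is what carries
  statements from dyadic endpoints to real ones.\<close>

lemma AE_jump_free_right:
  assumes "0 \<le> t"
  shows "AE \<omega> in M. eventually (\<lambda>m. \<not> J t (real (dyadic_succ m t) / 2 ^ m) \<omega>) sequentially"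
proof -
  let ?A = "\<lambda>m. {\<omega>\<in>space M. J t (real (dyadic_succ m t) / 2 ^ m) \<omega>}"
  have le: "t \<le> real (dyadic_succ m t) / 2 ^ m" for m
    using dyadic_succ_gt[of t m] by simp
  have "prob (?A m) \<le> r * (1 / 2) ^ m" for m
  proof -
    have "prob (?A m) \<le> r * (real (dyadic_succ m t) / 2 ^ m - t)"
      unfolding J_prob[OF assms le] by (rule one_minus_exp_le)
    also have "\<dots> \<le> r * (1 / 2 ^ m)"
      using dyadic_succ_le[OF assms, of m] r_nonneg by (intro mult_left_mono) auto
    finally show ?thesis by (simp add: power_divide)
  qed
  moreover have "summable (\<lambda>m. r * (1 / 2) ^ m)"
    by (intro summable_mult summable_geometric) simp
  ultimately have "summable (\<lambda>m. prob (?A m))"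
    by - (rule summable_comparison_test'[of "\<lambda>m. r * (1 / 2) ^ m" 0], auto)
  moreover have "?A m \<in> sets M" for m
    using J_measurable[OF assms le] by measurable
  ultimately have "AE \<omega> in M. eventually (\<lambda>m. \<omega> \<in> space M - ?A m) sequentially"
    by (intro borel_cantelli_AE1) (auto simp: emeasure_eq_measure)
  then show ?thesis
    by eventually_elim (auto elim: eventually_mono)
qed

text \<open>The interval from s to the dyadic point beyond t is split once at t and once at the
  dyadic point beyond s. For large m both short pieces are jump-free, leaving \<open>J s t\<close>
  equivalent to a jump in the dyadic block that the increment counts.\<close>

lemma AE_jump_iff:
  assumes st: "0 \<le> s" "s \<le> t"
  shows "AE \<omega> in M. J s t \<omega> \<longleftrightarrow> N t \<omega> - N s \<omega> > 0"
proof -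
  have t: "0 \<le> t" using st by simp
  let ?s = "\<lambda>m. real (dyadic_succ m s) / 2 ^ m" and ?t = "\<lambda>m. real (dyadic_succ m t) / 2 ^ m"
  have le: "s \<le> ?s m" "t \<le> ?t m" "?s m \<le> ?t m" for m
    using dyadic_succ_gt[of s m] dyadic_succ_gt[of t m] dyadic_succ_mono[OF st(2), of m]
    by (auto simp: divide_right_mono)
  have "AE \<omega> in M. \<forall>m. J s (?t m) \<omega> \<longleftrightarrow> J s t \<omega> \<or> J t (?t m) \<omega>"
    using J_split[OF st le(2)] by (simp add: AE_all_countable)
  moreover have "AE \<omega> in M. \<forall>m. J s (?t m) \<omega> \<longleftrightarrow> J s (?s m) \<omega> \<or> J (?s m) (?t m) \<omega>"
    using J_split[OF st(1) le(1) le(3)] by (simp add: AE_all_countable)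
  moreover have "AE \<omega> in M. \<forall>m. J (?s m) (?t m) \<omega> \<longleftrightarrow> (\<exists>i\<in>{dyadic_succ m s..<dyadic_succ m t}. grid J \<omega> m i)"
    using AE_block[OF dyadic_succ_mono[OF st(2)]] by (simp add: AE_all_countable)
  moreover note AE_jump_free_right[OF st(1)] AE_jump_free_right[OF t] AE_increment_eventually[OF st]
  ultimately show ?thesis
  proof eventually_elim
    case (elim \<omega>)
    note splits = elim(1)[rule_format] elim(2)[rule_format] elim(3)[rule_format]
    have "eventually (\<lambda>m. J s t \<omega> \<longleftrightarrow> N t \<omega> - N s \<omega> > 0) sequentially"
      using elim(4-6)
    proof eventually_elim
      case (elim m)
      have "J s t \<omega> \<longleftrightarrow> (\<exists>i\<in>{dyadic_succ m s..<dyadic_succ m t}. grid J \<omega> m i)"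
        using splits(1)[of m] splits(2)[of m] splits(3)[of m] elim(1,2) by argo
      also have "\<dots> \<longleftrightarrow> 0 < card {i\<in>{dyadic_succ m s..<dyadic_succ m t}. grid J \<omega> m i}"
        by (auto simp: card_gt_0_iff)
      finally show ?case using elim by simp
    qed
    then show ?case by simp
  qed
qed

end


subsection \<open>Joint independence of increments\<close>

lemma (in prob_space) prob_tendsto_AE:
  assumes [measurable]: "\<And>m. S m \<in> events" "A \<in> events"
    and "AE \<omega> in M. eventually (\<lambda>m. \<omega> \<in> S m \<longleftrightarrow> \<omega> \<in> A) sequentially"
  shows "(\<lambda>m. prob (S m)) \<longlonglongrightarrow> prob A"
proof -
  have "(\<lambda>m. \<integral>\<omega>. indicator (S m) \<omega> \<partial>M) \<longlonglongrightarrow> (\<integral>\<omega>. indicator A \<omega> \<partial>M :: real)"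
  proof (rule integral_dominated_convergence[where w="\<lambda>_. 1"])
    show "AE \<omega> in M. (\<lambda>m. indicator (S m) \<omega> :: real) \<longlonglongrightarrow> indicator A \<omega>"
      using assms(3)
    proof eventually_elim
      case (elim \<omega>)
      show ?case
        by (rule tendsto_eventually, use elim in eventually_elim) (auto simp: indicator_def)
    qed
  qed (auto simp: indicator_def)
  then show ?thesis by simp
qed

text \<open>
  Passing to the limit in the factorization of probabilities is done on the \<open>\<pi>\<close>-system of cylinders only:
  a cylinder restricts finitely many coordinates, so eventual equality of these suffices.
\<close>

lemma (in prob_space) indep_vars_PiM_limit:
  fixes X :: "'i \<Rightarrow> 'k \<Rightarrow> 'a \<Rightarrow> 'b"
  assumes I: "finite I"
    and Y: "\<And>m. indep_vars (\<lambda>i. \<Pi>\<^sub>M k\<in>K. count_space UNIV) (\<lambda>i \<omega>. \<lambda>k\<in>K. Y m i k \<omega>) I"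
    and X: "\<And>i k. i \<in> I \<Longrightarrow> k \<in> K \<Longrightarrow> X i k \<in> measurable M (count_space UNIV)"
    and lim: "\<And>i k. i \<in> I \<Longrightarrow> k \<in> K \<Longrightarrow>
      AE \<omega> in M. eventually (\<lambda>m::nat. Y m i k \<omega> = X i k \<omega>) sequentially"
  shows "indep_vars (\<lambda>i. \<Pi>\<^sub>M k\<in>K. count_space UNIV) (\<lambda>i \<omega>. \<lambda>k\<in>K. X i k \<omega>) I"
proof (cases "I = {}")
  case True
  then show ?thesis by (simp add: indep_vars_def2 indep_sets_def)
next
  case False
  let ?C = "\<lambda>_::'k. count_space (UNIV :: 'b set)"
  let ?X = "\<lambda>i \<omega>. \<lambda>k\<in>K. X i k \<omega>" and ?Y = "\<lambda>m i \<omega>. \<lambda>k\<in>K. Y m i k \<omega>"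
  have rvX: "random_variable (PiM K ?C) (?X i)" if "i \<in> I" for i
    using X that by (intro measurable_restrict) auto
  have rvY: "random_variable (PiM K ?C) (?Y m i)" if "i \<in> I" for i m
    using Y[of m] that by (auto simp: indep_vars_def2)
  show ?thesis
  proof (subst indep_vars_finite[where E="\<lambda>_. prod_algebra K ?C"])
    show "\<forall>A\<in>I \<rightarrow> prod_algebra K ?C.
      prob (\<Inter>j\<in>I. ?X j -` A j \<inter> space M) = (\<Prod>j\<in>I. prob (?X j -` A j \<inter> space M))"
    proof
      fix A assume A: "A \<in> I \<rightarrow> prod_algebra K ?C"
      then have A_sets: "A i \<in> sets (PiM K ?C)" if "i \<in> I" for i
        using that by (auto simp: sets_PiM)
      have conv: "AE \<omega> in M. eventually (\<lambda>m. ?Y m i \<omega> \<in> A i \<longleftrightarrow> ?X i \<omega> \<in> A i) sequentially" if i: "i \<in> I" for i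
      proof -
        have "A i \<in> prod_algebra K ?C" using A i by auto
        then obtain J E where JE: "A i = prod_emb K ?C J (Pi\<^sub>E J E)" "finite J" "J \<subseteq> K"
          by (rule prod_algebraE) auto
        have "AE \<omega> in M. \<forall>k\<in>J. eventually (\<lambda>m. Y m i k \<omega> = X i k \<omega>) sequentially"
          using JE lim[OF i] by (intro AE_finite_allI) auto
        then show ?thesis
        proof eventually_elim
          case (elim \<omega>)
          then have "eventually (\<lambda>m. \<forall>k\<in>J. Y m i k \<omega> = X i k \<omega>) sequentially"
            using JE by (intro eventually_ball_finite) auto
          then show ?case
          proof eventually_elim
            case (elim m)
            then have "restrict (?Y m i \<omega>) J = restrict (?X i \<omega>) J"
              using JE(3) by (auto simp: restrict_def fun_eq_iff)
            then show ?case unfolding JE(1) prod_emb_def by auto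
          qed
        qed
      qed
      have "(\<lambda>m. prob (?Y m i -` A i \<inter> space M)) \<longlonglongrightarrow> prob (?X i -` A i \<inter> space M)" if i: "i \<in> I" for i
      proof (rule prob_tendsto_AE)
        show "AE \<omega> in M. eventually (\<lambda>m. \<omega> \<in> ?Y m i -` A i \<inter> space M \<longleftrightarrow> \<omega> \<in> ?X i -` A i \<inter> space M) sequentially"
          using conv[OF i] by eventually_elim (auto elim: eventually_mono)
      qed (use measurable_sets[OF rvX[OF i] A_sets[OF i]] measurable_sets[OF rvY[OF i] A_sets[OF i]] in auto)
      then have 1: "(\<lambda>m. \<Prod>i\<in>I. prob (?Y m i -` A i \<inter> space M)) \<longlonglongrightarrow> (\<Prod>i\<in>I. prob (?X i -` A i \<inter> space M))"
        by (intro tendsto_prod)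
      have 2: "(\<lambda>m. prob (\<Inter>i\<in>I. ?Y m i -` A i \<inter> space M)) \<longlonglongrightarrow> prob (\<Inter>i\<in>I. ?X i -` A i \<inter> space M)"
      proof (rule prob_tendsto_AE)
        have "AE \<omega> in M. \<forall>i\<in>I. eventually (\<lambda>m. ?Y m i \<omega> \<in> A i \<longleftrightarrow> ?X i \<omega> \<in> A i) sequentially"
          using I conv by (intro AE_finite_allI) auto
        then show "AE \<omega> in M. eventually (\<lambda>m. \<omega> \<in> (\<Inter>i\<in>I. ?Y m i -` A i \<inter> space M) \<longleftrightarrow>
            \<omega> \<in> (\<Inter>i\<in>I. ?X i -` A i \<inter> space M)) sequentially"
        proof eventually_elim
          case (elim \<omega>)
          then have "eventually (\<lambda>m. \<forall>i\<in>I. ?Y m i \<omega> \<in> A i \<longleftrightarrow> ?X i \<omega> \<in> A i) sequentially"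
            using I by (intro eventually_ball_finite) auto
          then show ?case by eventually_elim auto
        qed
        show "(\<Inter>i\<in>I. ?X i -` A i \<inter> space M) \<in> events"
          by (intro sets.finite_INT I False measurable_sets[OF rvX A_sets])
        show "(\<Inter>i\<in>I. ?Y m i -` A i \<inter> space M) \<in> events" for m
          by (intro sets.finite_INT I False measurable_sets[OF rvY A_sets])
      qed
      have eq: "prob (\<Inter>i\<in>I. ?Y m i -` A i \<inter> space M) = (\<Prod>i\<in>I. prob (?Y m i -` A i \<inter> space M))" for m
        by (rule indep_varsD_finite[OF Y False I A_sets])
      show "prob (\<Inter>i\<in>I. ?X i -` A i \<inter> space M) = (\<Prod>i\<in>I. prob (?X i -` A i \<inter> space M))"
        by (rule LIMSEQ_unique[OF 2[unfolded eq] 1])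
    qed
    show "sets (PiM K ?C) = sigma_sets (space (PiM K ?C)) (prod_algebra K ?C)"
      by (simp add: sets_PiM space_PiM)
    show "space (PiM K ?C) \<in> prod_algebra K ?C"
      unfolding space_PiM by (rule space_in_prod_algebra)
    show "prod_algebra K ?C \<subseteq> Pow (space (PiM K ?C))"
      unfolding space_PiM by (rule prod_algebra_sets_into_space)
  qed (use False I rvX Int_stable_prod_algebra in auto)
qed

text \<open>At level m the counts over successive time intervals, for all k together, are functions
  of disjoint blocks of one independent sequence \<open>\<xi> m\<close>. Letting every
  \<open>\<Phi> k\<close> read the same \<open>\<xi>\<close> is what makes the independence joint in
  k.\<close>

lemma (in prob_space) jointly_independent_increments_of_grid:
  fixes \<xi> :: "nat \<Rightarrow> nat \<Rightarrow> 'a \<Rightarrow> 's"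
  assumes \<xi>: "\<And>m n. indep_vars (\<lambda>_. S) (\<lambda>i. \<xi> m i) {..<n}"
    and \<Phi>[measurable]: "\<And>k. k \<in> K \<Longrightarrow> Measurable.pred S (\<Phi> k)"
    and N: "\<And>k t. k \<in> K \<Longrightarrow> 0 \<le> t \<Longrightarrow> N k t \<in> measurable M (count_space UNIV)"
    and lim: "\<And>k s t. k \<in> K \<Longrightarrow> 0 \<le> s \<Longrightarrow> s \<le> t \<Longrightarrow>
      AE \<omega> in M. eventually (\<lambda>m. card {i\<in>{dyadic_succ m s..<dyadic_succ m t}. \<Phi> k (\<xi> m i \<omega>)} =
        N k t \<omega> - N k s \<omega>) sequentially"
  shows "jointly_independent_increments M K N"
  unfolding jointly_independent_increments_def
proof safe
  fix n :: nat and \<tau> :: "nat \<Rightarrow> real"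
  assume \<tau>0: "0 \<le> \<tau> 0" and \<tau>: "\<forall>i<n. \<tau> i \<le> \<tau> (Suc i)"
  have \<tau>_mono: "\<tau> i \<le> \<tau> j" if "i \<le> j" "j \<le> n" for i j
    using that by (induction j rule: dec_induct) (use \<tau> in \<open>auto intro: order_trans\<close>)
  have \<tau>_nonneg: "0 \<le> \<tau> i" if "i \<le> n" for i
    using \<tau>0 \<tau>_mono[of 0 i] that by simp
  let ?B = "\<lambda>m i. {dyadic_succ m (\<tau> i)..<dyadic_succ m (\<tau> (Suc i))}"
  show "indep_vars (\<lambda>i. Pi\<^sub>M K (\<lambda>k. count_space UNIV))
      (\<lambda>i \<omega>. \<lambda>k\<in>K. N k (\<tau> (Suc i)) \<omega> - N k (\<tau> i) \<omega>) {..<n}"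
  proof (rule indep_vars_PiM_limit[where Y="\<lambda>m i k \<omega>. card {j\<in>?B m i. \<Phi> k (\<xi> m j \<omega>)}"])
    fix m
    \<comment> \<open>Rounding up is monotone, so consecutive blocks share an endpoint but no
      cell.\<close>
    have disj: "disjoint_family_on (?B m) {..<n}"
    proof -
      have "?B m i \<inter> ?B m j = {}" if "i < j" "j < n" for i j
        using dyadic_succ_mono[OF \<tau>_mono[of "Suc i" j], of m] that by auto
      then show ?thesis
        unfolding disjoint_family_on_def
        by (metis Int_commute lessThan_iff linorder_neqE_nat)
    qed
    have "indep_vars (\<lambda>i. PiM (?B m i) (\<lambda>_. S)) (\<lambda>i \<omega>. restrict (\<lambda>j. \<xi> m j \<omega>) (?B m i)) {..<n}"
    proof (rule indep_vars_restrict[OF \<xi> _ disj])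
      fix i assume "i \<in> {..<n}"
      then show "?B m i \<subseteq> {..<dyadic_succ m (\<tau> n)}"
        using dyadic_succ_mono[OF \<tau>_mono[of "Suc i" n], of m] by auto
    qed
    then have "indep_vars (\<lambda>i. Pi\<^sub>M K (\<lambda>k. count_space UNIV))
      (\<lambda>i \<omega>. (\<lambda>f. \<lambda>k\<in>K. card {j\<in>?B m i. \<Phi> k (f j)}) (restrict (\<lambda>j. \<xi> m j \<omega>) (?B m i))) {..<n}"
    proof (rule indep_vars_compose2)
      fix i
      show "(\<lambda>f. \<lambda>k\<in>K. card {j\<in>?B m i. \<Phi> k (f j)}) \<in>
          measurable (PiM (?B m i) (\<lambda>_. S)) (Pi\<^sub>M K (\<lambda>k. count_space UNIV))"
      proof (intro measurable_restrict measurable_card_Collect)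
        fix k j assume "k \<in> K" "j \<in> ?B m i"
        then show "Measurable.pred (PiM (?B m i) (\<lambda>_. S)) (\<lambda>f. \<Phi> k (f j))"
          by (intro measurable_compose[OF measurable_component_singleton[of j] \<Phi>[of k]])
      qed simp
    qed
    also have "(\<lambda>i \<omega>. (\<lambda>f. \<lambda>k\<in>K. card {j\<in>?B m i. \<Phi> k (f j)}) (restrict (\<lambda>j. \<xi> m j \<omega>) (?B m i))) =
      (\<lambda>i \<omega>. \<lambda>k\<in>K. card {j\<in>?B m i. \<Phi> k (\<xi> m j \<omega>)})"
    proof -
      have "card {j\<in>?B m i. \<Phi> k (restrict (\<lambda>j. \<xi> m j \<omega>) (?B m i) j)} = card {j\<in>?B m i. \<Phi> k (\<xi> m j \<omega>)}"
        for i k \<omega> by (rule arg_cong[where f=card]) auto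
      then show ?thesis by presburger
    qed
    finally show "indep_vars (\<lambda>i. Pi\<^sub>M K (\<lambda>k. count_space UNIV))
      (\<lambda>i \<omega>. \<lambda>k\<in>K. card {j\<in>?B m i. \<Phi> k (\<xi> m j \<omega>)}) {..<n}" .
  next
    fix i k assume i: "i \<in> {..<n}" and k: "k \<in> K"
    have [measurable]: "N k (\<tau> (Suc i)) \<in> measurable M (count_space UNIV)"
      "N k (\<tau> i) \<in> measurable M (count_space UNIV)"
      using i k \<tau>_nonneg by (auto intro!: N)
    show "(\<lambda>\<omega>. N k (\<tau> (Suc i)) \<omega> - N k (\<tau> i) \<omega>) \<in> measurable M (count_space UNIV)"
      by measurable
    show "AE \<omega> in M. eventually (\<lambda>m. card {j\<in>?B m i. \<Phi> k (\<xi> m j \<omega>)} =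
        N k (\<tau> (Suc i)) \<omega> - N k (\<tau> i) \<omega>) sequentially"
      using i k \<tau>_nonneg \<tau> by (intro lim) auto
  qed simp
qed

lemma (in prob_space) independent_increments_of_joint:
  assumes "jointly_independent_increments M K N" "k \<in> K"
    and "0 \<le> \<tau> 0" "\<forall>i<n. \<tau> i \<le> \<tau> (Suc i)"
  shows "indep_vars (\<lambda>i. count_space UNIV) (\<lambda>i \<omega>. N k (\<tau> (Suc i)) \<omega> - N k (\<tau> i) \<omega>) {..<n::nat}"
proof -
  have "indep_vars (\<lambda>i. \<Pi>\<^sub>M k\<in>K. count_space UNIV)
      (\<lambda>i \<omega>. \<lambda>k\<in>K. N k (\<tau> (Suc i)) \<omega> - N k (\<tau> i) \<omega>) {..<n}"
    using assms unfolding jointly_independent_increments_def by blast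
  from indep_vars_compose2[OF this, of "\<lambda>_ f. f k" "\<lambda>_. count_space UNIV"] assms(2)
  show ?thesis by (simp add: measurable_component_singleton)
qed


subsection \<open>Commutation of independent realizations\<close>

lemma orthogonal_projection_symmetric:
  assumes "orthogonal_projection P"
  shows "inner (P x) y = inner x (P y)"
proof -
  obtain S where S: "\<And>x. P x \<in> S" "\<And>x y. y \<in> S \<Longrightarrow> orthogonal (x - P x) y"
    using assms unfolding orthogonal_projection_def by blast
  have "inner (P x) (y - P y) = 0" "inner (x - P x) (P y) = 0"
    using S(2)[OF S(1)] by (auto simp: orthogonal_def inner_commute)
  then show ?thesis by (simp add: inner_diff_left inner_diff_right)
qed

lemma orthogonal_projection_idem:
  assumes "orthogonal_projection P"
  shows "P (P x) = P x"
proof -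
  obtain S where S: "subspace S" "\<And>x. P x \<in> S" "\<And>x y. y \<in> S \<Longrightarrow> orthogonal (x - P x) y"
    using assms unfolding orthogonal_projection_def by blast
  have "P x - P (P x) \<in> S" using S by (intro subspace_diff)
  then have "orthogonal (P x - P (P x)) (P x - P (P x))" by (rule S(3))
  then show ?thesis by (simp add: orthogonal_def)
qed

lemma orthogonal_projection_norm_le:
  assumes "orthogonal_projection P"
  shows "norm (P x) \<le> norm x"
proof -
  have "(norm (P x))\<^sup>2 = inner x (P x)"
    unfolding power2_norm_eq_inner orthogonal_projection_symmetric[OF assms]
      orthogonal_projection_idem[OF assms] ..
  also have "\<dots> \<le> norm x * norm (P x)" by (rule norm_cauchy_schwarz)
  finally have "norm (P x) * norm (P x) \<le> norm x * norm (P x)" by (simp add: power2_eq_square)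
  then show ?thesis by (cases "P x = 0") auto
qed

lemma orthogonal_projection_id: "orthogonal_projection (blinfun_apply id_blinfun)"
  unfolding orthogonal_projection_def by (intro exI[of _ UNIV]) (auto simp: orthogonal_def)

lemma countable_closure_UNIV:
  "\<exists>C :: 'a::second_countable_topology set. countable C \<and> closure C = UNIV"
proof -
  obtain C :: "'a set" where C: "countable C" "\<And>X. open X \<Longrightarrow> X \<noteq> {} \<Longrightarrow> \<exists>d\<in>C. d \<in> X"
    by (rule countable_dense_setE) blast
  have "- closure C = {}"
    using C(2)[of "- closure C"] closure_subset[of C] by auto
  then show ?thesis using C(1) by auto
qed

lemma blinfun_eq_on_dense:
  fixes A B :: "'a::real_normed_vector \<Rightarrow>\<^sub>L 'b::real_normed_vector"
  assumes "closure C = UNIV" "\<And>x. x \<in> C \<Longrightarrow> A x = B x"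
  shows "A = B"
proof -
  have "closed {x. A x = B x}"
    by (intro closed_Collect_eq continuous_intros)
  then have "closure C \<subseteq> {x. A x = B x}"
    using assms(2) by (intro closure_minimal) auto
  then show ?thesis using assms(1) by (auto intro!: blinfun_eqI)
qed

lemma operator_family_AE:
  assumes "operator_family M A F" "countable C"
  shows "AE \<omega> in M. \<forall>x\<in>C. A x \<omega> = F \<omega> x"
  using assms unfolding operator_family_def by (subst AE_ball_countable) auto

text \<open>A countable dense set merges the exceptional sets of single vectors into one, and
  continuity does the rest.\<close>

lemma operator_family_unique:
  fixes A :: "'h::{real_inner, polish_space} \<Rightarrow> 'w \<Rightarrow> 'h"
  assumes "operator_family M A F" "operator_family M A F'"
  shows "AE \<omega> in M. F \<omega> = F' \<omega>"
proof -
  obtain C :: "'h set" where C: "countable C" "closure C = UNIV"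
    using countable_closure_UNIV by blast
  from operator_family_AE[OF assms(1) C(1)] operator_family_AE[OF assms(2) C(1)]
  show ?thesis
    by eventually_elim (rule blinfun_eq_on_dense[OF C(2)], simp)
qed

lemma (in prob_space) indep_var_of_indep_vars:
  assumes "indep_vars M' X I" "i \<in> I" "j \<in> I" "i \<noteq> j"
  shows "indep_var (M' i) (X i) (M' j) (X j)"
proof -
  have "indep_var (PiM {i} M') (\<lambda>\<omega>. restrict (\<lambda>i. X i \<omega>) {i}) (PiM {j} M') (\<lambda>\<omega>. restrict (\<lambda>i. X i \<omega>) {j})"
    using assms by (intro indep_var_restrict[OF assms(1)]) auto
  from indep_var_compose[OF this, of "\<lambda>f. f i" "M' i" "\<lambda>f. f j" "M' j"]
  show ?thesis
    by (simp add: measurable_component_singleton comp_def)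
qed

section \<open>The semigroup laws and realizations by genuine projections\<close>

locale projection_semigroup = prob_space M
  for M :: "'w measure"
    and G :: "real \<Rightarrow> real \<Rightarrow> 'h::{real_inner, polish_space} \<Rightarrow> 'w \<Rightarrow> 'h" +
  assumes fdp: "finite_dim_projection_semigroup M G"
begin

lemma semigroup: "random_operator_semigroup M G"
  using fdp by (simp add: finite_dim_projection_semigroup_def)

lemmas semigroup_props = semigroup[unfolded random_operator_semigroup_def]

lemma square_integrable:
  assumes "0 \<le> s" "s \<le> t"
  shows "square_integrable M (G s t x)"
proof -
  have "bounded_random_operator M (G s t)"
    using conjunct1[OF semigroup_props] assms by blast
  then show ?thesis
    by (simp add: bounded_random_operator_def strong_random_operator_def)
qed

lemma G_measurable: "0 \<le> s \<Longrightarrow> s \<le> t \<Longrightarrow> G s t x \<in> borel_measurable M"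
  using square_integrable unfolding square_integrable_def by blast

lemma random_field_measurable: "0 \<le> s \<Longrightarrow> s \<le> t \<Longrightarrow> random_field (G s t) \<in> measurable M field_space"
  unfolding random_field_def field_space_def using G_measurable
  by (auto intro!: measurable_PiM_single' simp: space_PiM)

lemma G_equidistributed_fields:
  "0 \<le> r \<Longrightarrow> 0 \<le> s \<Longrightarrow> s \<le> t \<Longrightarrow> equidistributed M (G s t) (G (s + r) (t + r))"
  using semigroup_props[THEN conjunct2, THEN conjunct1] by blast

lemma G_continuous_at_0: "((\<lambda>t. \<integral>\<omega>. (norm (G 0 t x \<omega> - x))\<^sup>2 \<partial>M) \<longlongrightarrow> 0) (at_right 0)"
  by (rule semigroup_props[THEN conjunct2, THEN conjunct2, THEN conjunct1, rule_format])

lemma G_indep: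
  fixes \<tau> :: "nat \<Rightarrow> real"
  assumes "0 \<le> \<tau> 0" "\<And>i. i < m \<Longrightarrow> \<tau> i \<le> \<tau> (Suc i)"
  shows "indep_vars (\<lambda>i. field_space) (\<lambda>i. random_field (G (\<tau> i) (\<tau> (Suc i)))) {..<m}"
  by (rule semigroup_props[THEN conjunct2, THEN conjunct2, THEN conjunct2, THEN conjunct1, rule_format])
    (use assms in auto)

lemma G_product:
  "0 \<le> r \<Longrightarrow> r \<le> s \<Longrightarrow> s \<le> t \<Longrightarrow>
    random_operator_eq M (random_operator_prod M (G r s) (G s t)) (G r t)"
  by (rule semigroup_props[THEN conjunct2, THEN conjunct2, THEN conjunct2, THEN conjunct2, THEN conjunct1, rule_format])
    auto

lemma G_refl: "0 \<le> r \<Longrightarrow> AE \<omega> in M. G r r x \<omega> = x"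
  using semigroup_props[THEN conjunct2, THEN conjunct2, THEN conjunct2, THEN conjunct2, THEN conjunct2]
  by (simp add: random_operator_eq_def)

lemma consecutive_fields_indep:
  assumes "0 \<le> r" "r \<le> s" "s \<le> t"
  shows "indep_var field_space (random_field (G r s)) field_space (random_field (G s t))"
proof -
  have "indep_vars (\<lambda>i. field_space) (\<lambda>i. random_field (G ([r, s, t] ! i) ([r, s, t] ! Suc i))) {..<2}"
    using assms by (intro G_indep) (auto simp: less_2_cases_iff)
  from indep_var_of_indep_vars[OF this, of 0 1] show ?thesis
    by simp
qed

lemma field_space_component: "(\<lambda>f. f x) \<in> measurable field_space borel"
  unfolding field_space_def by (rule measurable_component_singleton) simp

lemma G_equidistributed:
  assumes "0 \<le> s" "0 \<le> t"
  shows "distr M borel (G 0 t x) = distr M borel (G s (s + t) x)"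
proof -
  have "equidistributed M (G 0 t) (G (0 + s) (t + s))"
    using assms by (intro G_equidistributed_fields) auto
  then have "distr (distr M field_space (random_field (G 0 t))) borel (\<lambda>f. f x) =
      distr (distr M field_space (random_field (G s (s + t)))) borel (\<lambda>f. f x)"
    unfolding equidistributed_def by (simp add: add.commute)
  moreover have "distr (distr M field_space (random_field (G s t))) borel (\<lambda>f. f x) = distr M borel (G s t x)"
    if "0 \<le> s" "s \<le> t" for s t
    using that distr_distr[OF field_space_component random_field_measurable]
    by (simp add: comp_def) (simp add: random_field_def)
  ultimately show ?thesis
    using assms by simp
qed

lemma AE_shift:
  assumes "0 \<le> s" "0 \<le> t" "Measurable.pred borel Q" "AE \<omega> in M. Q (G 0 t x \<omega>)"
  shows "AE \<omega> in M. Q (G s (s + t) x \<omega>)"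
proof -
  have G: "G 0 t x \<in> borel_measurable M" "G s (s + t) x \<in> borel_measurable M"
    using assms by (auto intro!: G_measurable)
  have Q: "{y\<in>space borel. Q y} \<in> sets borel" using assms(3) by (simp add: pred_def)
  have "AE y in distr M borel (G 0 t x). Q y"
    using assms(4) by (subst AE_distr_iff[OF G(1) Q])
  then show ?thesis
    unfolding G_equidistributed[OF assms(1,2)] AE_distr_iff[OF G(2) Q] .
qed

lemma prob_shift:
  assumes "0 \<le> s" "0 \<le> t" "A \<in> sets borel"
  shows "prob {\<omega>\<in>space M. G s (s + t) x \<omega> \<in> A} = prob {\<omega>\<in>space M. G 0 t x \<omega> \<in> A}"
proof -
  have "{\<omega>\<in>space M. G s t x \<omega> \<in> A} = G s t x -` A \<inter> space M" for s t
    by auto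
  moreover have "prob (G s t x -` A \<inter> space M) = measure (distr M borel (G s t x)) A"
    if "0 \<le> s" "s \<le> t" for s t
    using that assms(3) by (intro measure_distr[symmetric] G_measurable)
  ultimately show ?thesis
    using assms G_equidistributed[OF assms(1,2)] by simp
qed

text \<open>A choice of representatives that are finite-dimensional projections at every \<omega>.
  Finite rank is granted only for \<open>s < t\<close>, so the diagonal is treated apart with the
  identity.\<close>

definition F :: "real \<Rightarrow> real \<Rightarrow> 'w \<Rightarrow> 'h \<Rightarrow>\<^sub>L 'h"
  where "F s t = (if s < t then (SOME F. operator_family M (G s t) F \<and>
      (\<forall>\<omega>\<in>space M. orthogonal_projection (blinfun_apply (F \<omega>)) \<and> finite_dim (range (blinfun_apply (F \<omega>)))))
    else (\<lambda>_. id_blinfun))"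

lemma F_pos:
  assumes "0 \<le> s" "s < t"
  shows "operator_family M (G s t) (F s t) \<and>
      (\<forall>\<omega>\<in>space M. orthogonal_projection (F s t \<omega>) \<and> finite_dim (range (F s t \<omega>)))"
proof -
  have "\<forall>s t. 0 \<le> s \<and> s < t \<longrightarrow> random_finite_dim_projection M (G s t)"
    using fdp unfolding finite_dim_projection_semigroup_def by (rule conjunct2)
  then have "random_finite_dim_projection M (G s t)"
    using assms by blast
  then have "\<exists>F. operator_family M (G s t) F \<and>
      (\<forall>\<omega>\<in>space M. orthogonal_projection (blinfun_apply (F \<omega>)) \<and> finite_dim (range (blinfun_apply (F \<omega>))))"
    unfolding random_finite_dim_projection_def by (rule conjunct2)
  from someI_ex[OF this] show ?thesis
    unfolding F_def if_P[OF assms(2)] .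
qed

lemma F_family: "0 \<le> s \<Longrightarrow> s \<le> t \<Longrightarrow> operator_family M (G s t) (F s t)"
  using F_pos[of s t] G_refl[of s] by (cases "s = t") (auto simp: operator_family_def F_def)

lemma F_AE: "0 \<le> s \<Longrightarrow> s \<le> t \<Longrightarrow> AE \<omega> in M. G s t x \<omega> = F s t \<omega> x"
  using F_family unfolding operator_family_def by blast

lemma F_projection: "0 \<le> s \<Longrightarrow> s \<le> t \<Longrightarrow> \<omega> \<in> space M \<Longrightarrow> orthogonal_projection (F s t \<omega>)"
  using F_pos[of s t] orthogonal_projection_id by (cases "s = t") (auto simp: F_def)

lemma F_finite: "0 \<le> s \<Longrightarrow> s < t \<Longrightarrow> \<omega> \<in> space M \<Longrightarrow> finite_dim (range (F s t \<omega>))"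
  using F_pos by blast

text \<open>The product law speaks of the arbitrarily chosen \<open>the_family\<close>; uniqueness
  up to null sets transfers it to \<open>F\<close>.\<close>

lemma F_mult:
  assumes "0 \<le> r" "r \<le> s" "s \<le> t"
  shows "AE \<omega> in M. F r t \<omega> = F r s \<omega> o\<^sub>L F s t \<omega>"
proof -
  obtain C :: "'h set" where C: "countable C" "closure C = UNIV"
    using countable_closure_UNIV by blast
  have fam: "operator_family M (G s t) (the_family M (G s t))" if "0 \<le> s" "s \<le> t" for s t
    unfolding the_family_def using F_family[OF that] by (rule someI[of "operator_family M (G s t)"])
  have "random_operator_eq M (random_operator_prod M (G r s) (G s t)) (G r t)"
    using assms by (rule G_product)
  then have 1: "AE \<omega> in M. \<forall>x\<in>C. the_family M (G r s) \<omega> (the_family M (G s t) \<omega> x) = G r t x \<omega>"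
    unfolding random_operator_eq_def random_operator_prod_def using C(1)
    by (subst AE_ball_countable) auto
  have 2: "AE \<omega> in M. the_family M (G r s) \<omega> = F r s \<omega>" "AE \<omega> in M. the_family M (G s t) \<omega> = F s t \<omega>"
    using assms by (auto intro!: operator_family_unique fam F_family)
  have 3: "AE \<omega> in M. \<forall>x\<in>C. G r t x \<omega> = F r t \<omega> x"
    using assms C(1) by (intro operator_family_AE F_family) auto
  from 1 2 3 show ?thesis
  proof eventually_elim
    case (elim \<omega>)
    show ?case
      by (rule blinfun_eq_on_dense[OF C(2)]) (use elim in auto)
  qed
qed

text \<open>For A, B the earlier and later factors, A and AB are both symmetric, so the forms (Bx,
  Ay) = (ABx, y) = (x, ABy) = (Ax, By) coincide.\<close>

lemma F_cross_symmetric: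
  assumes "0 \<le> r" "r \<le> s" "s \<le> t"
  shows "AE \<omega> in M. \<forall>x y. inner (F s t \<omega> x) (F r s \<omega> y) = inner (F r s \<omega> x) (F s t \<omega> y)"
  using F_mult[OF assms] AE_space
proof eventually_elim
  case (elim \<omega>)
  have proj: "orthogonal_projection (F r s \<omega>)" "orthogonal_projection (F s t \<omega>)" "orthogonal_projection (F r t \<omega>)"
    using assms elim(2) by (auto intro!: F_projection)
  have mult: "F r t \<omega> x = F r s \<omega> (F s t \<omega> x)" for x
    using elim(1) by simp
  show ?case
  proof (intro allI)
    fix x y
    have "inner (F s t \<omega> x) (F r s \<omega> y) = inner (F r t \<omega> x) y"
      using orthogonal_projection_symmetric[OF proj(1), of "F s t \<omega> x" y] mult[of x] by simp
    also have "\<dots> = inner x (F r t \<omega> y)"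
      by (rule orthogonal_projection_symmetric[OF proj(3)])
    also have "\<dots> = inner (F r s \<omega> x) (F s t \<omega> y)"
      using orthogonal_projection_symmetric[OF proj(1), of x "F s t \<omega> y"] mult[of y] by simp
    finally show "inner (F s t \<omega> x) (F r s \<omega> y) = inner (F r s \<omega> x) (F s t \<omega> y)" .
  qed
qed

text \<open>
  Commutation of \<open>A\<close> and \<open>B\<close> is expressed as symmetry of \<open>inner (B x) (A y)\<close>. This involves the values of each
  random field only at deterministic points, so the event is measurable in the product of the two field spaces.
\<close>

lemma F_cross_commute:
  assumes "0 < s" "0 < t"
  shows "AE \<omega>' in M. AE \<omega> in M. \<forall>x. F 0 s \<omega>' (F 0 t \<omega> x) = F 0 t \<omega> (F 0 s \<omega>' x)"
proof -
  obtain C :: "'h set" where C: "countable C" "closure C = UNIV"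
    using countable_closure_UNIV by blast
  let ?X = "random_field (G 0 s)" and ?Y = "random_field (G s (s + t))" and ?Z = "random_field (G 0 t)"
  have X: "?X \<in> measurable M field_space" and Y: "?Y \<in> measurable M field_space"
    and Z: "?Z \<in> measurable M field_space"
    using assms by (auto intro!: random_field_measurable)
  have "indep_var field_space ?X field_space ?Y"
    using assms by (intro consecutive_fields_indep) auto
  then have dist: "distr M field_space ?X \<Otimes>\<^sub>M distr M field_space ?Y =
      distr M (field_space \<Otimes>\<^sub>M field_space) (\<lambda>\<omega>. (?X \<omega>, ?Y \<omega>))"
    by (simp add: indep_var_distribution_eq)
  have eqd: "distr M field_space ?Y = distr M field_space ?Z"
  proof -
    have "equidistributed M (G 0 t) (G (0 + s) (t + s))"
      using assms by (intro G_equidistributed_fields) auto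
    then show ?thesis by (simp add: equidistributed_def add.commute)
  qed
  have "AE \<omega>' in M. AE \<omega> in M. inner (G 0 t x \<omega>) (G 0 s y \<omega>') = inner (G 0 s x \<omega>') (G 0 t y \<omega>)" for x y
  proof -
    let ?Q = "\<lambda>p :: ('h \<Rightarrow> 'h) \<times> ('h \<Rightarrow> 'h). inner (snd p x) (fst p y) = inner (fst p x) (snd p y)"
    have comp: "(\<lambda>p. fst p z) \<in> borel_measurable (field_space \<Otimes>\<^sub>M field_space)"
        "(\<lambda>p. snd p z) \<in> borel_measurable (field_space \<Otimes>\<^sub>M field_space)" for z :: 'h
      by (auto intro: measurable_compose[OF measurable_fst field_space_component]
          measurable_compose[OF measurable_snd field_space_component])
    have Q: "Measurable.pred (field_space \<Otimes>\<^sub>M field_space) ?Q"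
      using comp by measurable
    interpret X: prob_space "distr M field_space ?X" by (rule prob_space_distr[OF X])
    interpret Z: prob_space "distr M field_space ?Z" by (rule prob_space_distr[OF Z])
    interpret XZ: pair_sigma_finite "distr M field_space ?X" "distr M field_space ?Z" ..
    have "AE \<omega> in M. inner (G s (s + t) x \<omega>) (G 0 s y \<omega>) = inner (G 0 s x \<omega>) (G s (s + t) y \<omega>)"
    proof -
      have "AE \<omega> in M. \<forall>x y. inner (F s (s + t) \<omega> x) (F 0 s \<omega> y) = inner (F 0 s \<omega> x) (F s (s + t) \<omega> y)"
        using assms by (intro F_cross_symmetric) auto
      moreover have "AE \<omega> in M. G s (s + t) z \<omega> = F s (s + t) \<omega> z" "AE \<omega> in M. G 0 s z \<omega> = F 0 s \<omega> z" for z
        using assms by (auto intro!: F_AE)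
      note this[of x] this[of y]
      ultimately show ?thesis
        by eventually_elim (simp only:)
    qed
    then have "AE p in distr M (field_space \<Otimes>\<^sub>M field_space) (\<lambda>\<omega>. (?X \<omega>, ?Y \<omega>)). ?Q p"
      using Q X Y by (subst AE_distr_iff) (auto simp: random_field_def pred_def)
    \<comment> \<open>By independence the law of the pair is a product, and by stationarity its
      second factor is the law of \<open>G 0 t\<close>. Fubini then turns a statement at one
      \<omega> into one about two points chosen separately.\<close>
    then have "AE p in distr M field_space ?X \<Otimes>\<^sub>M distr M field_space ?Z. ?Q p"
      unfolding dist[symmetric] eqd .
    then have "AE f in distr M field_space ?X. AE g in distr M field_space ?Z. ?Q (f, g)"
      by (rule XZ.AE_pair)
    then have "AE \<omega>' in M. AE g in distr M field_space ?Z. ?Q (?X \<omega>', g)"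
      by (rule AE_distrD[OF X])
    then show ?thesis
      by eventually_elim (drule AE_distrD[OF Z], simp add: random_field_def)
  qed
  then have "AE \<omega>' in M. \<forall>p\<in>C \<times> C. AE \<omega> in M.
      inner (G 0 t (fst p) \<omega>) (G 0 s (snd p) \<omega>') = inner (G 0 s (fst p) \<omega>') (G 0 t (snd p) \<omega>)"
    using C(1) by (subst AE_ball_countable) auto
  moreover have "AE \<omega> in M. \<forall>x\<in>C. G 0 s x \<omega> = F 0 s \<omega> x"
    using assms C(1) by (intro operator_family_AE F_family) auto
  ultimately show ?thesis
    using AE_space
  proof eventually_elim
    case (elim \<omega>')
    have FA: "G 0 s x \<omega>' = F 0 s \<omega>' x" if "x \<in> C" for x
      using elim(2) that by blast
    have "AE \<omega> in M. \<forall>p\<in>C \<times> C.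
      inner (G 0 t (fst p) \<omega>) (G 0 s (snd p) \<omega>') = inner (G 0 s (fst p) \<omega>') (G 0 t (snd p) \<omega>)"
      using C(1) elim(1) by (subst AE_ball_countable) auto
    moreover have "AE \<omega> in M. \<forall>x\<in>C. G 0 t x \<omega> = F 0 t \<omega> x"
      using assms C(1) by (intro operator_family_AE F_family) auto
    ultimately show ?case
      using AE_space
    proof eventually_elim
      case (elim \<omega>)
      let ?A = "F 0 s \<omega>'" and ?B = "F 0 t \<omega>"
      have proj: "orthogonal_projection ?A" "orthogonal_projection ?B"
        using assms elim(3) \<open>\<omega>' \<in> space M\<close> by (auto intro!: F_projection)
      have form: "inner (?B x) (?A y) = inner (?A x) (?B y)" if "x \<in> C" "y \<in> C" for x y
        using elim(1)[rule_format, of "(x, y)"] elim(2)[rule_format, OF that(1)] elim(2)[rule_format, OF that(2)]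
          FA[OF that(1)] FA[OF that(2)] that by simp
      have "?A o\<^sub>L ?B = ?B o\<^sub>L ?A"
      proof (rule blinfun_eq_on_dense[OF C(2)])
        fix x assume x: "x \<in> C"
        have eq: "inner (?A (?B x) - ?B (?A x)) y = 0" if "y \<in> C" for y
          using form[OF x that] orthogonal_projection_symmetric[OF proj(1), of "?B x" y]
            orthogonal_projection_symmetric[OF proj(2), of "?A x" y]
          by (simp add: inner_diff_left)
        have "closed {y. inner (?A (?B x) - ?B (?A x)) y = 0}"
          by (intro closed_Collect_eq continuous_intros)
        then have "closure C \<subseteq> {y. inner (?A (?B x) - ?B (?A x)) y = 0}"
          using eq by (intro closure_minimal) auto
        then have "inner (?A (?B x) - ?B (?A x)) (?A (?B x) - ?B (?A x)) = 0"
          using C(2) by blast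
        then show "(?A o\<^sub>L ?B) x = (?B o\<^sub>L ?A) x" by simp
      qed
      from arg_cong[OF this, of blinfun_apply] show ?case
        by (simp add: fun_eq_iff)
    qed
  qed
qed

end


subsection \<open>Joint eigenvectors\<close>

text \<open>Distinct unit orthogonal vectors are at distance at least 1, so balls of radius 1/2
  around them are disjoint open sets in a second countable space.\<close>

lemma countable_orthonormal:
  fixes B :: "'a::{real_inner, second_countable_topology} set"
  assumes "pairwise orthogonal B" "\<And>b. b \<in> B \<Longrightarrow> norm b = 1"
  shows "countable B"
proof -
  have far: "1 \<le> dist b c" if "b \<in> B" "c \<in> B" "b \<noteq> c" for b c
  proof -
    have "(norm (b - c))\<^sup>2 = 2"
      using that assms by (simp add: power2_norm_eq_inner inner_diff_left inner_diff_right inner_commute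
          pairwise_def orthogonal_def norm_eq_1)
    then have "1\<^sup>2 \<le> (norm (b - c))\<^sup>2" by simp
    then show ?thesis unfolding dist_norm by (rule power2_le_imp_le) simp
  qed
  have disj: "ball b (1 / 2) \<inter> ball c (1 / 2) = {}" if "b \<in> B" "c \<in> B" "b \<noteq> c" for b c
  proof (rule ccontr)
    assume "ball b (1 / 2) \<inter> ball c (1 / 2) \<noteq> {}"
    then obtain x where "dist b x < 1 / 2" "dist c x < 1 / 2" by auto
    then show False using far[OF that] dist_triangle2[of b c x] by simp
  qed
  have "inj_on (\<lambda>b. ball b (1 / 2)) B"
  proof (rule inj_onI, rule ccontr)
    fix b c assume bc: "b \<in> B" "c \<in> B" "ball b (1 / 2) = ball c (1 / 2)" "b \<noteq> c"
    have "b \<in> ball b (1 / 2)" by simp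
    then show False using disj[OF bc(1,2,4)] bc(3) by auto
  qed
  moreover have "countable ((\<lambda>b. ball b (1 / 2)) ` B)"
  proof (rule countable_disjoint_open_subsets)
    show "disjoint ((\<lambda>b. ball b (1 / 2)) ` B)"
      using disj by (auto simp: disjoint_def)
  qed auto
  ultimately show ?thesis
    using countable_image_inj_on by blast
qed

lemma finite_dim_subspace:
  assumes "finite_dim V" "subspace W" "W \<subseteq> V"
  shows "finite_dim W"
proof -
  obtain B where B: "finite B" "V = span B" using assms(1) unfolding finite_dim_def by blast
  obtain C where C: "C \<subseteq> W" "independent C" "W \<subseteq> span C" by (rule basis_exists[of W])
  have "finite C" using independent_span_bound[OF B(1) C(2)] C(1) assms(3) B(2) by auto
  moreover have "W = span C" by (rule antisym[OF C(3) span_minimal[OF C(1) assms(2)]])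
  ultimately show ?thesis unfolding finite_dim_def by blast
qed

lemma blinfun_subspace_vimage: "subspace W \<Longrightarrow> subspace {x. blinfun_apply A x \<in> W}"
  by (auto simp: subspace_def blinfun.add_right blinfun.scaleR_right)

context projection_semigroup
begin

definition pos_rats :: "real set" where "pos_rats = {t\<in>\<rat>. 0 < t}"

text \<open>The null set may depend on the vector; this weak form is what can be checked directly,
  and \<open>invariant_AE\<close> upgrades it by means of a finite spanning set.\<close>

definition invariant :: "'h set \<Rightarrow> bool"
  where "invariant W \<longleftrightarrow> subspace W \<and> finite_dim W \<and>
    (\<forall>t\<in>pos_rats. \<forall>v\<in>W. AE \<omega> in M. F 0 t \<omega> v \<in> W)"

text \<open>The eigenvalue, 0 or 1, is random and may vary with t. Only countably many times are
  constrained here; arbitrary times follow by continuity.\<close>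

definition joint_eigenvector :: "'h \<Rightarrow> bool"
  where "joint_eigenvector e \<longleftrightarrow> norm e = 1 \<and> (\<forall>t\<in>pos_rats. AE \<omega> in M. F 0 t \<omega> e \<in> {0, e})"

lemma countable_pos_rats: "countable pos_rats"
  unfolding pos_rats_def by (rule countable_subset[OF _ countable_rat]) auto

lemma pos_rats_pos: "t \<in> pos_rats \<Longrightarrow> 0 < t"
  by (simp add: pos_rats_def)

lemma invariant_AE:
  assumes "invariant W" "t \<in> pos_rats"
  shows "AE \<omega> in M. \<forall>v\<in>W. F 0 t \<omega> v \<in> W"
proof -
  obtain B where B: "finite B" "W = span B"
    using assms unfolding invariant_def finite_dim_def by blast
  have "AE \<omega> in M. \<forall>b\<in>B. F 0 t \<omega> b \<in> W"
    using assms B span_superset[of B] unfolding invariant_def by (intro AE_finite_allI) auto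
  then show ?thesis
  proof eventually_elim
    case (elim \<omega>)
    have "span B \<subseteq> {x. F 0 t \<omega> x \<in> W}"
      using elim B by (intro span_minimal blinfun_subspace_vimage) auto
    then show ?case using B by auto
  qed
qed

lemma cross_commute_AE:
  assumes "t \<in> pos_rats"
  shows "AE \<omega>' in M. \<forall>t'\<in>pos_rats. AE \<omega> in M. \<forall>x. F 0 t \<omega>' (F 0 t' \<omega> x) = F 0 t' \<omega> (F 0 t \<omega>' x)"
  using assms F_cross_commute pos_rats_pos countable_pos_rats by (subst AE_ball_countable) auto

text \<open>
  On a minimal invariant subspace \<open>G\<^sub>0\<^sub>,\<^sub>t\<close> is almost surely \<open>0\<close> or the identity, because almost every
  realization of it has an invariant range. Induction on the dimension replaces the choice of a minimal subspace.
\<close>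

lemma invariant_imp_eigenvector:
  assumes "invariant V" "V \<noteq> {0}"
  shows "\<exists>e\<in>V. joint_eigenvector e"
proof -
  have *: "invariant V \<Longrightarrow> V = span B \<Longrightarrow> finite B \<Longrightarrow> V \<noteq> {0} \<Longrightarrow> \<exists>e\<in>V. joint_eigenvector e" for V B
  proof (induction "card B" arbitrary: V B rule: less_induct)
    case less
    have sub: "subspace V" using less.prems(1) by (simp add: invariant_def)
    show ?case
    proof (cases "\<forall>t\<in>pos_rats. AE \<omega> in M. (\<forall>v\<in>V. F 0 t \<omega> v = 0) \<or> (\<forall>v\<in>V. F 0 t \<omega> v = v)")
      case True
      obtain v where v: "v \<in> V" "v \<noteq> 0" using less.prems(4) subspace_0[OF sub] by blast
      let ?e = "inverse (norm v) *\<^sub>R v"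
      have e: "?e \<in> V" using v sub by (intro subspace_scale)
      have "AE \<omega> in M. F 0 t \<omega> ?e \<in> {0, ?e}" if "t \<in> pos_rats" for t
        using True[rule_format, OF that] by eventually_elim (use e in blast)
      then have "joint_eigenvector ?e"
        unfolding joint_eigenvector_def using v by auto
      then show ?thesis using e by blast
    next
      case False
      then obtain t where t: "t \<in> pos_rats"
        and not: "\<not> (AE \<omega> in M. (\<forall>v\<in>V. F 0 t \<omega> v = 0) \<or> (\<forall>v\<in>V. F 0 t \<omega> v = v))" by blast
      \<comment> \<open>The set of nontrivial realizations is not null, so it meets the almost sure
        event on which invariance and commutation hold.\<close>
      have "\<exists>\<omega>'. \<omega>' \<in> space M \<and> (\<forall>v\<in>V. F 0 t \<omega>' v \<in> V) \<and>
        (\<forall>t'\<in>pos_rats. AE \<omega> in M. \<forall>x. F 0 t \<omega>' (F 0 t' \<omega> x) = F 0 t' \<omega> (F 0 t \<omega>' x)) \<and>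
        \<not> ((\<forall>v\<in>V. F 0 t \<omega>' v = 0) \<or> (\<forall>v\<in>V. F 0 t \<omega>' v = v))"
      proof (rule ccontr)
        assume none: "\<not> ?thesis"
        from AE_space invariant_AE[OF less.prems(1) t] cross_commute_AE[OF t]
        have "AE \<omega> in M. (\<forall>v\<in>V. F 0 t \<omega> v = 0) \<or> (\<forall>v\<in>V. F 0 t \<omega> v = v)"
          by eventually_elim (use none in blast)
        then show False using not by blast
      qed
      then obtain \<omega>' where \<omega>': "\<omega>' \<in> space M" and inV: "\<And>v. v \<in> V \<Longrightarrow> F 0 t \<omega>' v \<in> V"
        and comm: "\<And>t'. t' \<in> pos_rats \<Longrightarrow> AE \<omega> in M. \<forall>x. F 0 t \<omega>' (F 0 t' \<omega> x) = F 0 t' \<omega> (F 0 t \<omega>' x)"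
        and not0: "\<not> (\<forall>v\<in>V. F 0 t \<omega>' v = 0)" and not1: "\<not> (\<forall>v\<in>V. F 0 t \<omega>' v = v)"
        by blast
      let ?P = "F 0 t \<omega>'"
      let ?U = "?P ` V"
      have proj: "orthogonal_projection ?P"
        using \<omega>' pos_rats_pos[OF t] by (intro F_projection) auto
      have U_sub: "subspace ?U"
        using sub by (intro linear_subspace_image bounded_linear.linear blinfun.bounded_linear_right)
      have UV: "?U \<subseteq> V" using inV by blast
      have fin: "finite_dim V" using less.prems unfolding finite_dim_def by blast
      have U_fin: "finite_dim ?U" by (rule finite_dim_subspace[OF fin U_sub UV])
      have "AE \<omega> in M. F 0 t' \<omega> u \<in> ?U" if t': "t' \<in> pos_rats" and u: "u \<in> ?U" for t' u
      proof -
        obtain v where v: "v \<in> V" "u = ?P v" using u by blast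
        from comm[OF t'] invariant_AE[OF less.prems(1) t'] show ?thesis
        proof eventually_elim
          case (elim \<omega>)
          have "F 0 t' \<omega> u = ?P (F 0 t' \<omega> v)"
            using elim(1) v(2) by simp
          then show ?case using elim(2) v(1) by blast
        qed
      qed
      then have inv: "invariant ?U"
        unfolding invariant_def using U_sub U_fin by blast
      \<comment> \<open>An idempotent is the identity on its range, and the realization was chosen
        different from the identity on V.\<close>
      have "?U \<noteq> V"
      proof
        assume eq: "?U = V"
        have "?P v = v" if v: "v \<in> V" for v
        proof -
          obtain w where "v = ?P w" using v eq by blast
          then show ?thesis using orthogonal_projection_idem[OF proj, of w] by simp
        qed
        then show False using not1 by blast
      qed
      \<comment> \<open>\<open>B\<close> is just a finite spanning set, so the measure drops by
        exhibiting an independent set in V with one more element than a basis C of the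
        image.\<close>
      then obtain v where v: "v \<in> V" "v \<notin> ?U" using UV by blast
      obtain C where C: "C \<subseteq> ?U" "independent C" "?U \<subseteq> span C" by (rule basis_exists[of ?U])
      have U_span: "?U = span C" by (rule antisym[OF C(3) span_minimal[OF C(1) U_sub]])
      have vC: "v \<notin> span C" using v(2) unfolding U_span .
      then have "v \<notin> C" using span_base by metis
      have "independent (insert v C)"
        using C(2) vC by (simp add: independent_insert)
      moreover have "C \<subseteq> V" by (rule subset_trans[OF C(1) UV])
      then have "insert v C \<subseteq> span B"
        unfolding less.prems(2)[symmetric] using v(1) by simp
      ultimately have "finite (insert v C) \<and> card (insert v C) \<le> card B"
        by (intro independent_span_bound less.prems(3))
      then have C': "finite C" "card C < card B" using \<open>v \<notin> C\<close> by auto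
      have "?U \<noteq> {0}"
      proof
        assume "?U = {0}"
        then have "\<forall>v\<in>V. ?P v = 0" by (metis imageI singletonD)
        then show False using not0 by (rule notE[rotated])
      qed
      from less.hyps[OF C'(2) inv U_span C'(1) this]
      obtain e where "e \<in> ?U" "joint_eigenvector e" by (rule bexE)
      then show ?thesis using UV by (intro bexI[of _ e] subsetD[OF UV])
    qed
  qed
  obtain B where "finite B" "V = span B"
    using assms(1) unfolding invariant_def finite_dim_def by blast
  then show ?thesis using * assms by blast
qed

section \<open>Completeness of the joint eigenvectors\<close>

lemma small_time:
  assumes "0 < \<epsilon>"
  obtains t where "t \<in> pos_rats" "(\<integral>\<omega>. (norm (G 0 t x \<omega> - x))\<^sup>2 \<partial>M) < \<epsilon>"
proof -
  have "eventually (\<lambda>t. (\<integral>\<omega>. (norm (G 0 t x \<omega> - x))\<^sup>2 \<partial>M) < \<epsilon>) (at_right 0)"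
    using G_continuous_at_0 assms by (rule order_tendstoD(2))
  then obtain b where b: "0 < b" "\<And>t. 0 < t \<Longrightarrow> t < b \<Longrightarrow> (\<integral>\<omega>. (norm (G 0 t x \<omega> - x))\<^sup>2 \<partial>M) < \<epsilon>"
    unfolding eventually_at_right_field by blast
  obtain q where q: "q \<in> \<rat>" "0 < q" "q < b"
    using Rats_dense_in_real[OF b(1)] by blast
  show thesis
    by (rule that[of q]) (use q b in \<open>auto simp: pos_rats_def\<close>)
qed

lemma norm_G_le:
  assumes "0 \<le> s" "s \<le> t"
  shows "AE \<omega> in M. norm (G s t x \<omega>) \<le> norm x"
  using F_AE[OF assms, of x] AE_space
proof eventually_elim
  case (elim \<omega>)
  have "norm (F s t \<omega> x) \<le> norm x"
    by (intro orthogonal_projection_norm_le F_projection assms elim(2))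
  then show ?case using elim(1) by simp
qed

lemma integrable_displacement:
  assumes "0 \<le> s" "s \<le> t"
  shows "integrable M (\<lambda>\<omega>. (norm (G s t x \<omega> - y))\<^sup>2)"
proof (rule integrable_const_bound)
  show "AE \<omega> in M. norm ((norm (G s t x \<omega> - y))\<^sup>2) \<le> (norm x + norm y)\<^sup>2"
    using norm_G_le[OF assms, of x]
  proof eventually_elim
    case (elim \<omega>)
    have "norm (G s t x \<omega> - y) \<le> norm x + norm y"
      using norm_triangle_ineq4[of "G s t x \<omega>" y] elim by simp
    then show ?case by (simp add: power_mono)
  qed
  note [measurable] = G_measurable[OF assms]
  show "(\<lambda>\<omega>. (norm (G s t x \<omega> - y))\<^sup>2) \<in> borel_measurable M" by measurable
qed

lemma joint_eigenvector_fixed_or_killed: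
  assumes "countable B" "\<And>b. b \<in> B \<Longrightarrow> joint_eigenvector b" "t \<in> pos_rats"
  shows "AE \<omega> in M. \<forall>b\<in>B. F 0 t \<omega> b \<in> {0, b}"
  using assms unfolding joint_eigenvector_def by (subst AE_ball_countable) auto

text \<open>
  The range of a realization of \<open>G\<^sub>0\<^sub>,\<^sub>t\<close> is spanned by a maximal orthonormal system of joint eigenvectors, since
  the part orthogonal to the system is invariant. As \<open>G\<^sub>0\<^sub>,\<^sub>t x\<close> is close to \<open>x\<close> for small \<open>t\<close>, the system is
  complete.
\<close>

lemma eigenbasis_exists:
  "\<exists>B. pairwise orthogonal B \<and> (\<forall>b\<in>B. joint_eigenvector b) \<and> closure (span B) = UNIV"
proof -
  let ?A = "{B. pairwise orthogonal B \<and> (\<forall>b\<in>B. joint_eigenvector b)}"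
  have "\<exists>B\<in>?A. \<forall>X\<in>?A. B \<subseteq> X \<longrightarrow> X = B"
  proof (rule subset_Zorn')
    fix C assume C: "subset.chain ?A C"
    have "pairwise orthogonal (\<Union>C)"
      using C by (intro pairwise_chain_Union) (auto simp: subset_chain_def chain_subset_def)
    then show "\<Union>C \<in> ?A" using C by (auto simp: subset_chain_def)
  qed
  then obtain B where B: "pairwise orthogonal B" "\<And>b. b \<in> B \<Longrightarrow> joint_eigenvector b"
    and B_max: "\<And>X. X \<in> ?A \<Longrightarrow> B \<subseteq> X \<Longrightarrow> X = B" by auto
  have norm_B: "norm b = 1" if "b \<in> B" for b using B(2)[OF that] by (simp add: joint_eigenvector_def)
  have countable_B: "countable B" by (rule countable_orthonormal[OF B(1) norm_B])
  have indep_B: "independent B"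
    by (rule pairwise_orthogonal_independent[OF B(1)]) (use norm_B in force)
  have "\<exists>y\<in>span B. dist y w < \<epsilon>" if \<epsilon>: "0 < \<epsilon>" for w \<epsilon>
  proof -
    obtain t where t: "t \<in> pos_rats" and small: "(\<integral>\<omega>. (norm (G 0 t w \<omega> - w))\<^sup>2 \<partial>M) < \<epsilon>\<^sup>2"
      using small_time[of "\<epsilon>\<^sup>2" w] \<epsilon> by auto
    have t0: "0 < t" by (rule pos_rats_pos[OF t])
    have fixed: "AE \<omega> in M. \<forall>b\<in>B. F 0 t \<omega> b \<in> {0, b}" if "t \<in> pos_rats" for t
      using B(2) that by (intro joint_eigenvector_fixed_or_killed countable_B) auto
    \<comment> \<open>A displacement of at least \<epsilon> almost everywhere would contradict the
      mean-square bound \<open>\<epsilon>\<^sup>2\<close> by which t was chosen; so suitable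
      realizations move w by less than \<epsilon>.\<close>
    have not_far: "\<not> (AE \<omega> in M. \<epsilon> \<le> norm (G 0 t w \<omega> - w))"
    proof
      assume far: "AE \<omega> in M. \<epsilon> \<le> norm (G 0 t w \<omega> - w)"
      have "(\<integral>\<omega>. \<epsilon>\<^sup>2 \<partial>M) \<le> (\<integral>\<omega>. (norm (G 0 t w \<omega> - w))\<^sup>2 \<partial>M)"
        using far t0 \<epsilon> by (intro integral_mono_AE integrable_displacement) (auto elim!: eventually_mono intro: power_mono)
      then show False using small by (simp add: prob_space)
    qed
    have "\<exists>\<omega>'. \<omega>' \<in> space M \<and> G 0 t w \<omega>' = F 0 t \<omega>' w \<and> (\<forall>b\<in>B. F 0 t \<omega>' b \<in> {0, b}) \<and>
      (\<forall>t'\<in>pos_rats. AE \<omega> in M. \<forall>x. F 0 t \<omega>' (F 0 t' \<omega> x) = F 0 t' \<omega> (F 0 t \<omega>' x)) \<and>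
      \<not> \<epsilon> \<le> norm (G 0 t w \<omega>' - w)"
    proof (rule ccontr)
      assume none: "\<not> ?thesis"
      from AE_space F_AE[OF order_refl less_imp_le[OF t0], of w] cross_commute_AE[OF t]
        fixed[OF t]
      have "AE \<omega> in M. \<epsilon> \<le> norm (G 0 t w \<omega> - w)"
        by eventually_elim (use none in blast)
      then show False using not_far by blast
    qed
    then obtain \<omega>' where \<omega>': "\<omega>' \<in> space M" and close: "norm (F 0 t \<omega>' w - w) < \<epsilon>"
      and eig: "\<And>b. b \<in> B \<Longrightarrow> F 0 t \<omega>' b \<in> {0, b}"
      and comm: "\<And>t'. t' \<in> pos_rats \<Longrightarrow> AE \<omega> in M. \<forall>x. F 0 t \<omega>' (F 0 t' \<omega> x) = F 0 t' \<omega> (F 0 t \<omega>' x)"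
      by (auto simp: not_le)
    let ?P = "F 0 t \<omega>'"
    have proj: "orthogonal_projection ?P" using \<omega>' t0 by (intro F_projection) auto
    have range_sub: "subspace (range ?P)"
      by (intro linear_subspace_image bounded_linear.linear blinfun.bounded_linear_right subspace_UNIV)
    have range_fin: "finite_dim (range ?P)" using \<omega>' t0 by (intro F_finite) auto
    \<comment> \<open>The part of the range not captured by \<open>B\<close>. An eigenvector in it
      could be adjoined to \<open>B\<close>, against maximality, so it is zero.\<close>
    let ?V = "{v\<in>range ?P. \<forall>b\<in>B. inner v b = 0}"
    have V_sub: "subspace ?V"
      using range_sub by (auto simp: subspace_def inner_add_left)
    have "AE \<omega> in M. F 0 t' \<omega> v \<in> ?V" if t': "t' \<in> pos_rats" and v: "v \<in> ?V" for t' v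
    proof -
      obtain x where x: "v = ?P x" using v by blast
      from comm[OF t'] fixed[OF t'] AE_space show ?thesis
      proof eventually_elim
        case (elim \<omega>)
        have proj': "orthogonal_projection (F 0 t' \<omega>)"
          using elim(3) pos_rats_pos[OF t'] by (intro F_projection) auto
        have "F 0 t' \<omega> v = ?P (F 0 t' \<omega> x)" using elim(1) x by simp
        moreover have "inner (F 0 t' \<omega> v) b = 0" if "b \<in> B" for b
          using orthogonal_projection_symmetric[OF proj', of v b] elim(2) v that by auto
        ultimately show ?case by blast
      qed
    qed
    then have V_inv: "invariant ?V"
      unfolding invariant_def using V_sub finite_dim_subspace[OF range_fin V_sub] by blast
    have V_no_eig: "\<not> joint_eigenvector e" if e: "e \<in> ?V" for e
    proof
      assume je: "joint_eigenvector e"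
      have "pairwise orthogonal (insert e B)"
        using B(1) e by (auto simp: pairwise_insert orthogonal_def inner_commute)
      then have "insert e B = B" using B(2) je by (intro B_max) auto
      then have "e \<in> B" by blast
      then have "inner e e = 0" using e by blast
      then show False using je by (simp add: joint_eigenvector_def)
    qed
    have V0: "?V = {0}"
    proof (rule ccontr)
      assume "?V \<noteq> {0}"
      from invariant_imp_eigenvector[OF V_inv this] obtain e where e: "e \<in> ?V" "joint_eigenvector e"
        by (rule bexE)
      from V_no_eig[OF e(1)] e(2) show False by (rule notE)
    qed
    \<comment> \<open>The members of \<open>B\<close> fixed by the realization; they are independent
      in its finite-dimensional range, hence finitely many, and all others are killed.\<close>
    let ?BP = "{b\<in>B. ?P b = b}"
    have BP_range: "b \<in> range ?P" if "b \<in> ?BP" for b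
    proof -
      have "?P b = b" using that by simp
      then show ?thesis by (metis rangeI)
    qed
    have "finite ?BP"
    proof -
      obtain C where C: "finite C" "range ?P = span C" using range_fin unfolding finite_dim_def by blast
      have "?BP \<subseteq> span C" using BP_range C(2) by blast
      moreover have "independent ?BP" using indep_B by (rule independent_mono) auto
      ultimately show ?thesis using independent_span_bound[OF C(1)] by simp
    qed
    \<comment> \<open>The residual of the Fourier expansion of \<open>?P w\<close>. It is orthogonal
      to fixed members of \<open>B\<close> by construction and to killed ones by symmetry of the
      projection, so it lies in \<open>?V\<close>.\<close>
    let ?v = "?P w - (\<Sum>b\<in>?BP. inner (?P w) b *\<^sub>R b)"
    have "?v \<in> range ?P"
      using range_sub by (intro subspace_diff subspace_sum subspace_scale) (use BP_range in auto)
    moreover have "inner ?v c = 0" if c: "c \<in> B" for c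
    proof (cases "?P c = c")
      case True
      have "(\<Sum>b\<in>?BP. inner (?P w) b * inner b c) = (\<Sum>b\<in>{c}. inner (?P w) b * inner b c)"
        using B(1) c True \<open>finite ?BP\<close>
        by (intro sum.mono_neutral_right) (auto simp: pairwise_def orthogonal_def)
      then show ?thesis
        using norm_B[OF c] by (simp add: inner_diff_left inner_sum_left norm_eq_1)
    next
      case False
      then have "?P c = 0" using eig[OF c] by simp
      then have "inner (?P w) c = 0"
        using orthogonal_projection_symmetric[OF proj, of w c] by simp
      moreover have "(\<Sum>b\<in>?BP. inner (?P w) b * inner b c) = 0"
        using B(1) c False by (intro sum.neutral) (auto simp: pairwise_def orthogonal_def)
      ultimately show ?thesis by (simp add: inner_diff_left inner_sum_left)
    qed
    ultimately have "?v \<in> ?V" by blast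
    then have "?P w = (\<Sum>b\<in>?BP. inner (?P w) b *\<^sub>R b)" unfolding V0 by simp
    moreover have "(\<Sum>b\<in>?BP. inner (?P w) b *\<^sub>R b) \<in> span B"
      by (intro span_sum span_scale span_base) auto
    ultimately show ?thesis using close by (intro bexI[of _ "?P w"]) (auto simp: dist_norm)
  qed
  then have "closure (span B) = UNIV"
    by (auto simp: closure_approachable)
  then show ?thesis using B by blast
qed

text \<open>For rational q just below t, \<open>G 0 t e\<close> is the contraction
  \<open>F 0 q\<close> applied to \<open>G q t e\<close>, while \<open>F 0 q\<close> sends e to 0 or
  e. So the distance of \<open>G 0 t e\<close> from {0, e} is at most the displacement of e over the
  short interval from q to t, which is small in mean square.\<close>

lemma joint_eigenvector_dichotomy_0:
  assumes e: "joint_eigenvector e" and t: "0 \<le> t"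
  shows "AE \<omega> in M. G 0 t e \<omega> \<in> {0, e}"
proof (cases "t = 0")
  case True
  then show ?thesis using G_refl[of 0 e] by auto
next
  case False
  with t have t: "0 < t" by simp
  \<comment> \<open>The squared distance to the set {0, e}.\<close>
  let ?\<rho> = "\<lambda>\<omega>. (min (norm (G 0 t e \<omega>)) (norm (G 0 t e \<omega> - e)))\<^sup>2"
  have [measurable]: "G 0 t e \<in> borel_measurable M" using t by (intro G_measurable) auto
  have int: "integrable M ?\<rho>"
    by (rule Bochner_Integration.integrable_bound[OF integrable_displacement[of 0 t e 0]])
      (use t in \<open>auto intro!: power_mono\<close>)
  have "(\<integral>\<omega>. ?\<rho> \<omega> \<partial>M) < \<epsilon>" if "0 < \<epsilon>" for \<epsilon>
  proof -
    have "eventually (\<lambda>h. (\<integral>\<omega>. (norm (G 0 h e \<omega> - e))\<^sup>2 \<partial>M) < \<epsilon>) (at_right 0)"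
      using G_continuous_at_0 that by (rule order_tendstoD(2))
    then obtain b where b: "0 < b" "\<And>h. 0 < h \<Longrightarrow> h < b \<Longrightarrow> (\<integral>\<omega>. (norm (G 0 h e \<omega> - e))\<^sup>2 \<partial>M) < \<epsilon>"
      unfolding eventually_at_right_field by blast
    obtain q where q: "q \<in> \<rat>" "max 0 (t - b) < q" "q < t"
      using Rats_dense_in_real[of "max 0 (t - b)" t] b(1) t by auto
    have "AE \<omega> in M. F 0 q \<omega> e \<in> {0, e}"
      using e q by (auto simp: joint_eigenvector_def pos_rats_def)
    moreover have "AE \<omega> in M. F 0 t \<omega> = F 0 q \<omega> o\<^sub>L F q t \<omega>"
      using q by (intro F_mult) auto
    moreover have "AE \<omega> in M. G 0 t e \<omega> = F 0 t \<omega> e" "AE \<omega> in M. G q t e \<omega> = F q t \<omega> e"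
      using q t by (auto intro!: F_AE)
    ultimately have "AE \<omega> in M. ?\<rho> \<omega> \<le> (norm (G q t e \<omega> - e))\<^sup>2"
      using AE_space
    proof eventually_elim
      case (elim \<omega>)
      have "G 0 t e \<omega> - F 0 q \<omega> e = F 0 q \<omega> (G q t e \<omega> - e)"
        using elim(2-4) by (simp add: blinfun.diff_right)
      moreover have "norm (F 0 q \<omega> (G q t e \<omega> - e)) \<le> norm (G q t e \<omega> - e)"
        using elim(5) q by (intro orthogonal_projection_norm_le F_projection) auto
      ultimately have "norm (G 0 t e \<omega> - F 0 q \<omega> e) \<le> norm (G q t e \<omega> - e)" by simp
      then have "min (norm (G 0 t e \<omega>)) (norm (G 0 t e \<omega> - e)) \<le> norm (G q t e \<omega> - e)"
        using elim(1) by (auto simp: min_le_iff_disj)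
      then show ?case by (intro power_mono) auto
    qed
    then have "(\<integral>\<omega>. ?\<rho> \<omega> \<partial>M) \<le> (\<integral>\<omega>. (norm (G q t e \<omega> - e))\<^sup>2 \<partial>M)"
      using q by (intro integral_mono_AE int integrable_displacement) auto
    \<comment> \<open>Continuity is known at time 0 only, so the displacement over (q, t] is moved
      there through equality of laws.\<close>
    also have "\<dots> = (\<integral>y. (norm (y - e))\<^sup>2 \<partial>distr M borel (G q (q + (t - q)) e))"
      using q by (subst integral_distr) (auto intro!: G_measurable)
    also have "\<dots> = (\<integral>y. (norm (y - e))\<^sup>2 \<partial>distr M borel (G 0 (t - q) e))"
      using q G_equidistributed[of q "t - q" e] by simp
    also have "\<dots> = (\<integral>\<omega>. (norm (G 0 (t - q) e \<omega> - e))\<^sup>2 \<partial>M)"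
      using q by (subst integral_distr) (auto intro!: G_measurable)
    also have "\<dots> < \<epsilon>" using q by (intro b(2)) auto
    finally show ?thesis .
  qed
  from this[of "\<integral>\<omega>. ?\<rho> \<omega> \<partial>M"] have "(\<integral>\<omega>. ?\<rho> \<omega> \<partial>M) \<le> 0" by force
  moreover have "0 \<le> (\<integral>\<omega>. ?\<rho> \<omega> \<partial>M)" by (intro integral_nonneg_AE) auto
  ultimately have "(\<integral>\<omega>. ?\<rho> \<omega> \<partial>M) = 0" by simp
  then have "AE \<omega> in M. ?\<rho> \<omega> = 0"
    by (subst (asm) integral_nonneg_eq_0_iff_AE[OF int]) auto
  then show ?thesis
    by eventually_elim (auto simp: min_def split: if_splits)
qed

lemma joint_eigenvector_dichotomy:
  assumes "joint_eigenvector e" "0 \<le> s" "s \<le> t"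
  shows "AE \<omega> in M. G s t e \<omega> \<in> {0, e}"
proof -
  have "Measurable.pred borel (\<lambda>y. y \<in> {0, e})" by measurable
  moreover have "AE \<omega> in M. G 0 (t - s) e \<omega> \<in> {0, e}"
    using assms by (intro joint_eigenvector_dichotomy_0) auto
  ultimately have "AE \<omega> in M. G s (s + (t - s)) e \<omega> \<in> {0, e}"
    using assms by (intro AE_shift[where Q="\<lambda>y. y \<in> {0, e}"]) auto
  then show ?thesis by simp
qed

end


subsection \<open>Poisson processes of the eigenvectors\<close>

text \<open>Positivity comes from writing p at t as a power of p at a small time. Then f = - ln p is
  additive and nondecreasing, and comparing \<open>n * t\<close> with its integer part gives
  \<open>n * \<bar>f t - f 1 * t\<bar> \<le> f 1\<close> for all n; the rate is
  \<open>f 1\<close>.\<close>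

lemma multiplicative_imp_exponential:
  fixes p :: "real \<Rightarrow> real"
  assumes mult: "\<And>s t. 0 \<le> s \<Longrightarrow> 0 \<le> t \<Longrightarrow> p (s + t) = p s * p t"
    and p0: "p 0 = 1" and nonneg: "\<And>t. 0 \<le> t \<Longrightarrow> 0 \<le> p t" and le1: "\<And>t. 0 \<le> t \<Longrightarrow> p t \<le> 1"
    and lim: "(p \<longlongrightarrow> 1) (at_right 0)"
  shows "\<exists>r\<ge>0. \<forall>t\<ge>0. p t = exp (- (r * t))"
proof -
  have power: "p (real n * t) = p t ^ n" if "0 \<le> t" for n t
  proof (induction n)
    case (Suc n)
    have "p (real (Suc n) * t) = p (t + real n * t)" by (simp add: algebra_simps)
    also have "\<dots> = p t * p (real n * t)" using that by (intro mult) auto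
    finally show ?case using Suc by simp
  qed (simp add: p0)
  have pos: "0 < p t" if t: "0 \<le> t" for t
  proof (cases "t = 0")
    case False
    have "eventually (\<lambda>h. 0 < p h) (at_right 0)"
      using lim by (rule order_tendstoD(1)) simp
    then obtain b where b: "0 < b" "\<And>h. 0 < h \<Longrightarrow> h < b \<Longrightarrow> 0 < p h"
      unfolding eventually_at_right_field by blast
    obtain n :: nat where n: "t / b < real n" using reals_Archimedean2 by blast
    then have "0 < real n" using t b(1) by (metis divide_nonneg_pos le_less_trans)
    then have "t / real n < b" using n b(1) by (simp add: field_simps)
    then have "0 < p (t / real n)"
      using False t \<open>0 < real n\<close> by (intro b(2)) auto
    then have "0 < p (t / real n) ^ n" by simp
    also have "p (t / real n) ^ n = p (real n * (t / real n))" using t by (intro power[symmetric]) simp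
    finally show ?thesis using \<open>0 < real n\<close> by simp
  qed (simp add: p0)
  define f where "f t = - ln (p t)" for t
  have f_nonneg: "0 \<le> f t" if "0 \<le> t" for t
    using pos[OF that] le1[OF that] by (simp add: f_def ln_le_zero_iff)
  have f_add: "f (s + t) = f s + f t" if "0 \<le> s" "0 \<le> t" for s t
    using pos[OF that(1)] pos[OF that(2)] by (simp add: f_def mult[OF that] ln_mult)
  have f_nat: "f (real n * t) = real n * f t" if "0 \<le> t" for n t
    using pos[OF that] by (simp add: f_def power[OF that] ln_realpow)
  have f_mono: "f s \<le> f t" if "0 \<le> s" "s \<le> t" for s t
    using f_add[of s "t - s"] f_nonneg[of "t - s"] that by simp
  have f1: "0 \<le> f 1" by (rule f_nonneg) simp
  have f_linear: "f t = f 1 * t" if t: "0 \<le> t" for t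
  proof -
    have bound: "real n * \<bar>f t - f 1 * t\<bar> \<le> f 1" for n
    proof -
      let ?k = "nat \<lfloor>real n * t\<rfloor>"
      have k: "real ?k \<le> real n * t" "real n * t \<le> real ?k + 1" using t by auto
      have "f (real ?k) \<le> f (real n * t)" "f (real n * t) \<le> f (real ?k + 1)"
        using k t by (auto intro!: f_mono)
      moreover have "f (real ?k) = real ?k * f 1" "f (real n * t) = real n * f t"
        using f_nat[of 1 ?k] f_nat[OF t, of n] by auto
      moreover have "f (real ?k + 1) = real ?k * f 1 + f 1"
        using f_add[of "real ?k" 1] f_nat[of 1 ?k] by simp
      moreover have "real ?k * f 1 \<le> real n * t * f 1"
        using k f1 by (intro mult_right_mono)
      moreover have "real n * t * f 1 \<le> real ?k * f 1 + f 1"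
        using mult_right_mono[OF k(2) f1] by (simp add: distrib_right)
      ultimately have "\<bar>real n * f t - real n * t * f 1\<bar> \<le> f 1"
        by linarith
      moreover have "real n * \<bar>f t - f 1 * t\<bar> = \<bar>real n * (f t - f 1 * t)\<bar>"
        by (simp add: abs_mult)
      ultimately show ?thesis by (simp add: algebra_simps)
    qed
    show ?thesis
    proof (rule ccontr)
      assume "f t \<noteq> f 1 * t"
      then obtain n :: nat where "f 1 < real n * \<bar>f t - f 1 * t\<bar>"
        using reals_Archimedean3[of "\<bar>f t - f 1 * t\<bar>"] by auto
      then show False using bound[of n] by simp
    qed
  qed
  have "p t = exp (- (f 1 * t))" if "0 \<le> t" for t
  proof -
    have "p t = exp (- f t)" using pos[OF that] by (simp add: f_def)
    then show ?thesis using f_linear[OF that] by simp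
  qed
  then show ?thesis using f1 by blast
qed

section \<open>Survival of a fixed eigenvector\<close>

context projection_semigroup
begin

context
  fixes e
  assumes e: "joint_eigenvector e"
begin

lemma norm_e: "norm e = 1"
  using e by (simp add: joint_eigenvector_def)

lemma fixed_measurable: "0 \<le> s \<Longrightarrow> s \<le> t \<Longrightarrow> {\<omega>\<in>space M. G s t e \<omega> = e} \<in> events"
  using measurable_sets[OF G_measurable[of s t e], of "{e}"] by (simp add: vimage_def Int_def conj_commute)

text \<open>The later factor acts first and returns 0 or e; in the first case the product is 0,
  which differs from e, and in the second the earlier factor decides.\<close>

lemma fixed_split:
  assumes "0 \<le> r" "r \<le> s" "s \<le> t"
  shows "AE \<omega> in M. G r t e \<omega> = e \<longleftrightarrow> G r s e \<omega> = e \<and> G s t e \<omega> = e"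
proof -
  have st: "0 \<le> s" "r \<le> t" using assms by auto
  from F_mult[OF assms] F_AE[OF assms(1,2), of e] F_AE[OF st(1) assms(3), of e] F_AE[OF assms(1) st(2), of e]
    joint_eigenvector_dichotomy[OF e assms(1,2)] joint_eigenvector_dichotomy[OF e st(1) assms(3)]
  show ?thesis
  proof eventually_elim
    case (elim \<omega>)
    have "e \<noteq> 0" using norm_e by auto
    moreover have "G r t e \<omega> = F r s \<omega> (G s t e \<omega>)" using elim(1,3,4) by simp
    ultimately show ?case using elim(2,5,6) by auto
  qed
qed

definition survival :: "real \<Rightarrow> real"
  where "survival t = prob {\<omega>\<in>space M. G 0 t e \<omega> = e}"

lemma survival_shift: "0 \<le> s \<Longrightarrow> s \<le> t \<Longrightarrow> prob {\<omega>\<in>space M. G s t e \<omega> = e} = survival (t - s)"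
  using prob_shift[of s "t - s" "{e}" e] by (simp add: survival_def)

lemma survival_mult:
  assumes "0 \<le> s" "0 \<le> t"
  shows "survival (s + t) = survival s * survival t"
proof -
  have le: "s \<le> s + t" using assms by simp
  let ?E = "{f\<in>space field_space. f e = e}"
  have E: "?E \<in> sets field_space"
  proof -
    have "?E = (\<lambda>f. f e) -` {e} \<inter> space field_space" by auto
    then show ?thesis using measurable_sets[OF field_space_component, of "{e}"] by simp
  qed
  have vimage: "random_field (G s t) -` ?E \<inter> space M = {\<omega>\<in>space M. G s t e \<omega> = e}"
    if "0 \<le> s" "s \<le> t" for s t
    using measurable_space[OF random_field_measurable[OF that]] by (auto simp: random_field_def)
  have "survival (s + t) = prob {\<omega>\<in>space M. G 0 s e \<omega> = e \<and> G s (s + t) e \<omega> = e}"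
    unfolding survival_def
  proof (rule finite_measure_eq_AE)
    show "AE \<omega> in M. (\<omega> \<in> {\<omega>\<in>space M. G 0 (s + t) e \<omega> = e}) =
        (\<omega> \<in> {\<omega>\<in>space M. G 0 s e \<omega> = e \<and> G s (s + t) e \<omega> = e})"
      using fixed_split[of 0 s "s + t"] assms by auto
    have "{\<omega>\<in>space M. G 0 s e \<omega> = e \<and> G s (s + t) e \<omega> = e} =
        {\<omega>\<in>space M. G 0 s e \<omega> = e} \<inter> {\<omega>\<in>space M. G s (s + t) e \<omega> = e}" by auto
    then show "{\<omega>\<in>space M. G 0 s e \<omega> = e \<and> G s (s + t) e \<omega> = e} \<in> events"
      using assms by (auto intro!: fixed_measurable sets.Int)
  qed (use assms in \<open>auto intro!: fixed_measurable\<close>)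
  also have "{\<omega>\<in>space M. G 0 s e \<omega> = e \<and> G s (s + t) e \<omega> = e} =
      (\<lambda>\<omega>. (random_field (G 0 s) \<omega>, random_field (G s (s + t)) \<omega>)) -` (?E \<times> ?E) \<inter> space M"
  proof -
    have "(\<lambda>\<omega>. (X \<omega>, Y \<omega>)) -` (?E \<times> ?E) \<inter> space M = (X -` ?E \<inter> space M) \<inter> (Y -` ?E \<inter> space M)"
      for X Y :: "'w \<Rightarrow> 'h \<Rightarrow> 'h" by auto
    moreover have "random_field (G 0 s) -` ?E \<inter> space M = {\<omega>\<in>space M. G 0 s e \<omega> = e}"
      "random_field (G s (s + t)) -` ?E \<inter> space M = {\<omega>\<in>space M. G s (s + t) e \<omega> = e}"
      by (rule vimage[OF order_refl assms(1)], rule vimage[OF assms(1) le])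
    ultimately show ?thesis by auto
  qed
  also have "prob \<dots> = prob (random_field (G 0 s) -` ?E \<inter> space M) * prob (random_field (G s (s + t)) -` ?E \<inter> space M)"
    using assms by (intro indep_varD[OF _ E E] consecutive_fields_indep) auto
  finally show ?thesis
    unfolding vimage[OF order_refl assms(1)] vimage[OF assms(1) le] survival_shift[OF assms(1) le]
    by (simp add: survival_def)
qed

text \<open>The squared displacement of the unit vector e is almost surely the indicator of being
  killed, so its mean is one minus the survival probability.\<close>

lemma survival_tendsto: "(survival \<longlongrightarrow> 1) (at_right 0)"
proof -
  have "(\<integral>\<omega>. (norm (G 0 t e \<omega> - e))\<^sup>2 \<partial>M) = 1 - survival t" if "0 < t" for t
  proof -
    let ?A = "{\<omega>\<in>space M. G 0 t e \<omega> = e}"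
    have A[measurable]: "?A \<in> events" using that by (intro fixed_measurable) auto
    have [measurable]: "G 0 t e \<in> borel_measurable M" using that by (intro G_measurable) auto
    have "(\<integral>\<omega>. (norm (G 0 t e \<omega> - e))\<^sup>2 \<partial>M) = (\<integral>\<omega>. 1 - indicator ?A \<omega> \<partial>M)"
    proof (rule integral_cong_AE)
      show "AE \<omega> in M. (norm (G 0 t e \<omega> - e))\<^sup>2 = 1 - indicator ?A \<omega>"
        using joint_eigenvector_dichotomy[OF e order_refl less_imp_le[OF that]] AE_space
        by eventually_elim (auto simp: indicator_def norm_e)
    qed measurable
    also have "\<dots> = 1 - prob ?A"
      by (subst Bochner_Integration.integral_diff) (auto simp: prob_space emeasure_eq_measure)
    finally show ?thesis by (simp add: survival_def)
  qed
  then have "eventually (\<lambda>t. 1 - (\<integral>\<omega>. (norm (G 0 t e \<omega> - e))\<^sup>2 \<partial>M) = survival t) (at_right 0)"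
    unfolding eventually_at_right_field by (intro exI[of _ 1]) auto
  moreover have "((\<lambda>t. 1 - (\<integral>\<omega>. (norm (G 0 t e \<omega> - e))\<^sup>2 \<partial>M)) \<longlongrightarrow> 1 - 0) (at_right 0)"
    by (intro tendsto_intros G_continuous_at_0)
  ultimately show ?thesis by (simp add: Lim_transform_eventually)
qed

text \<open>A jump is encoded as \<open>\<noteq> e\<close> instead of \<open>= 0\<close>: the two
  agree almost surely, and the former is the exact complement of survival.\<close>

lemma eigenvector_jump_family: "\<exists>r. jump_family M (\<lambda>s t \<omega>. G s t e \<omega> \<noteq> e) r"
proof -
  have "survival 0 = 1"
    unfolding survival_def using G_refl[of 0 e] fixed_measurable[of 0 0] prob_eq_1[of "{\<omega>\<in>space M. G 0 0 e \<omega> = e}"]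
    by auto
  moreover have "0 \<le> survival t" "survival t \<le> 1" for t
    by (simp_all add: survival_def)
  ultimately obtain r where r: "0 \<le> r" "\<And>t. 0 \<le> t \<Longrightarrow> survival t = exp (- (r * t))"
    using multiplicative_imp_exponential[OF survival_mult _ _ _ survival_tendsto] by blast
  have "jump_family M (\<lambda>s t \<omega>. G s t e \<omega> \<noteq> e) r"
  proof
    fix s t :: real assume st: "0 \<le> s" "s \<le> t"
    show pred: "Measurable.pred M (\<lambda>\<omega>. G s t e \<omega> \<noteq> e)"
      using fixed_measurable[OF st] by (simp add: pred_def)
    have "prob {\<omega>\<in>space M. G s t e \<omega> \<noteq> e} = 1 - prob {\<omega>\<in>space M. G s t e \<omega> = e}"
      by (rule prob_neg[OF fixed_measurable[OF st]])
    then show "prob {\<omega>\<in>space M. G s t e \<omega> \<noteq> e} = 1 - exp (- (r * (t - s)))"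
      using survival_shift[OF st] r(2)[of "t - s"] st by simp
  next
    fix s t u :: real assume "0 \<le> s" "s \<le> t" "t \<le> u"
    from fixed_split[OF this]
    show "AE \<omega> in M. (G s u e \<omega> \<noteq> e) = (G s t e \<omega> \<noteq> e \<or> G t u e \<omega> \<noteq> e)"
      by eventually_elim simp
  next
    fix m n
    have "indep_vars (\<lambda>i. field_space) (\<lambda>i. random_field (G (real i / 2 ^ m) (real (Suc i) / 2 ^ m))) {..<n}"
      by (rule G_indep) (auto simp: divide_right_mono)
    then have "indep_vars (\<lambda>_. count_space UNIV)
        (\<lambda>i \<omega>. (\<lambda>f. f e \<noteq> e) (random_field (G (real i / 2 ^ m) (real (Suc i) / 2 ^ m)) \<omega>)) {..<n}"
      by (rule indep_vars_compose2) (intro measurable_compose[OF field_space_component], measurable)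
    then show "indep_vars (\<lambda>_. count_space UNIV) (\<lambda>i \<omega>. grid (\<lambda>s t \<omega>. G s t e \<omega> \<noteq> e) \<omega> m i) {..<n}"
      by (simp add: grid_def random_field_def)
  qed (rule r(1))
  then show ?thesis by blast
qed

end

end

text \<open>Partial sums are best approximations: if v in the span of finitely many basis vectors is
  \<epsilon>-close to u, then by Pythagoras so is the partial sum over any finite index set
  containing theirs.\<close>

lemma orthonormal_basis_has_sum:
  assumes "orthonormal_basis K e"
  shows "((\<lambda>k. inner u (e k) *\<^sub>R e k) has_sum u) K"
proof -
  have ortho: "inner (e j) (e k) = (if j = k then 1 else 0)" if "j \<in> K" "k \<in> K" for j k
    using assms that by (auto simp: orthonormal_basis_def)
  have "eventually (\<lambda>Y. dist (\<Sum>k\<in>Y. inner u (e k) *\<^sub>R e k) u < \<epsilon>) (finite_subsets_at_top K)"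
    if \<epsilon>: "0 < \<epsilon>" for \<epsilon>
  proof -
    have "u \<in> closure (span (e ` K))" using assms by (simp add: orthonormal_basis_def)
    then obtain v where v: "v \<in> span (e ` K)" "dist v u < \<epsilon>"
      using \<epsilon> by (auto simp: closure_approachable)
    obtain T c where T: "finite T" "T \<subseteq> e ` K" "v = (\<Sum>a\<in>T. c a *\<^sub>R a)"
      using v(1) unfolding span_explicit by blast
    obtain X where X: "X \<subseteq> K" "finite X" "T = e ` X"
      using finite_subset_image[OF T(1,2)] by blast
    have "dist (\<Sum>k\<in>Y. inner u (e k) *\<^sub>R e k) u < \<epsilon>" if Y: "finite Y" "X \<subseteq> Y" "Y \<subseteq> K" for Y
    proof -
      let ?w = "\<Sum>k\<in>Y. inner u (e k) *\<^sub>R e k"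
      have perp: "inner (u - ?w) (e j) = 0" if j: "j \<in> Y" for j
      proof -
        have "inner ?w (e j) = (\<Sum>k\<in>Y. if k = j then inner u (e k) else 0)"
          unfolding inner_sum_left using Y(3) j by (intro sum.cong) (auto simp: ortho subset_iff)
        then show ?thesis using Y(1) j by (simp add: inner_diff_left)
      qed
      have sub: "subspace {y. inner (u - ?w) y = 0}"
        by (auto simp: subspace_def inner_add_right)
      have "span (e ` Y) \<subseteq> {y. inner (u - ?w) y = 0}"
        using perp by (intro span_minimal sub) auto
      moreover have "?w - v \<in> span (e ` Y)"
        unfolding T(3) using X(3) Y(2)
        by (intro span_diff span_sum span_scale span_base) auto
      ultimately have "inner (u - ?w) (?w - v) = 0" by blast
      then have "(norm (u - v))\<^sup>2 = (norm (u - ?w))\<^sup>2 + (norm (?w - v))\<^sup>2"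
        using norm_add_Pythagorean[of "u - ?w" "?w - v"] by (simp add: orthogonal_def)
      then have "norm (u - ?w) \<le> norm (u - v)"
        by - (rule power2_le_imp_le, auto)
      then show ?thesis using v(2) by (simp add: dist_norm norm_minus_commute)
    qed
    then show ?thesis
      unfolding eventually_finite_subsets_at_top using X by blast
  qed
  then show ?thesis
    unfolding has_sum_def tendsto_iff by blast
qed

text \<open>A finite orthonormal set with dense span already spans, since the Fourier residual is
  orthogonal to a dense set, so its cardinality is the dimension; an infinite one is countable and
  rules out finite dimension.\<close>

lemma orthonormal_set_enumeration:
  fixes B :: "'h::{real_inner, second_countable_topology} set"
  assumes B: "pairwise orthogonal B" "\<And>b. b \<in> B \<Longrightarrow> norm b = 1" "closure (span B) = UNIV"
  shows "\<exists>e. bij_betw e (basis_index (UNIV :: 'h set)) B"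
proof -
  have indep: "independent B"
    by (rule pairwise_orthogonal_independent[OF B(1)]) (use B(2) in force)
  show ?thesis
  proof (cases "finite B")
    case True
    have "span B = UNIV"
    proof -
      have "u \<in> span B" for u
      proof -
        let ?w = "u - (\<Sum>b\<in>B. inner u b *\<^sub>R b)"
        have perp: "inner ?w c = 0" if c: "c \<in> B" for c
        proof -
          have "(\<Sum>b\<in>B. inner u b * inner b c) = (\<Sum>b\<in>B. if b = c then inner u b else 0)"
            using B(1,2) c by (intro sum.cong) (auto simp: pairwise_def orthogonal_def norm_eq_1)
          then show ?thesis using True c by (simp add: inner_diff_left inner_sum_left)
        qed
        have sub: "subspace {y. inner ?w y = 0}"
          by (auto simp: subspace_def inner_add_right)
        have "span B \<subseteq> {y. inner ?w y = 0}"
          using perp by (intro span_minimal sub) auto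
        moreover have "closed {y. inner ?w y = 0}"
          by (intro closed_Collect_eq continuous_intros)
        ultimately have "closure (span B) \<subseteq> {y. inner ?w y = 0}"
          by (rule closure_minimal)
        then have "inner ?w ?w = 0" using B(3) by blast
        then have "u = (\<Sum>b\<in>B. inner u b *\<^sub>R b)" by simp
        moreover have "(\<Sum>b\<in>B. inner u b *\<^sub>R b) \<in> span B"
          by (intro span_sum span_scale span_base)
        ultimately show ?thesis by simp
      qed
      then show ?thesis by blast
    qed
    then have "finite_dim (UNIV :: 'h set)" "dim (UNIV :: 'h set) = card B"
      using True dim_span_eq_card_independent[OF indep] by (auto simp: finite_dim_def)
    then show ?thesis
      using ex_bij_betw_nat_finite_1[OF True] by (simp add: basis_index_def)
  next
    case False
    have "\<not> finite_dim (UNIV :: 'h set)"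
    proof
      assume "finite_dim (UNIV :: 'h set)"
      then obtain C :: "'h set" where C: "finite C" "UNIV = span C" unfolding finite_dim_def by blast
      then have "finite B" using independent_span_bound[OF C(1) indep] by auto
      then show False using False by simp
    qed
    \<comment> \<open>The index set starts at 1, the library enumeration at 0.\<close>
    moreover have "bij_betw (\<lambda>k::nat. k - 1) {1..} UNIV"
      by (rule bij_betw_byWitness[of _ Suc]) auto
    then have "bij_betw (from_nat_into B \<circ> (\<lambda>k. k - 1)) {1..} B"
      using countable_orthonormal[OF B(1,2)] False
      by (intro bij_betw_trans[OF _ bij_betw_from_nat_into]) auto
    ultimately show ?thesis unfolding basis_index_def by auto
  qed
qed

theorem theorem3p1:
  fixes M :: "'w measure"
    and G :: "real \<Rightarrow> real \<Rightarrow> 'h::{real_inner, polish_space} \<Rightarrow> 'w \<Rightarrow> 'h"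
  assumes "prob_space M"
    and "finite_dim_projection_semigroup M G"
  shows "\<exists>(e :: nat \<Rightarrow> 'h) (rate :: nat \<Rightarrow> real) (n :: nat \<Rightarrow> real \<Rightarrow> 'w \<Rightarrow> nat).
    orthonormal_basis (basis_index (UNIV :: 'h set)) e \<and>
    (\<forall>k\<in>basis_index (UNIV :: 'h set). poisson_process M (rate k) (n k)) \<and>
    jointly_independent_increments M (basis_index (UNIV :: 'h set)) n \<and>
    (\<forall>s t u. 0 \<le> s \<and> s \<le> t \<longrightarrow>
      (AE \<omega> in M.
        ((\<lambda>k. (inner u (e k) * no_jump (n k) s t \<omega>) *\<^sub>R e k) has_sum G s t u \<omega>)
          (basis_index (UNIV :: 'h set))))"
proof -
  interpret projection_semigroup M G
    using assms by (simp add: projection_semigroup_def projection_semigroup_axioms_def)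
  let ?K = "basis_index (UNIV :: 'h set)"
  obtain B where B: "pairwise orthogonal B" "\<And>b. b \<in> B \<Longrightarrow> joint_eigenvector b" "closure (span B) = UNIV"
    using eigenbasis_exists by blast
  have norm_B: "norm b = 1" if "b \<in> B" for b
    using B(2)[OF that] by (simp add: joint_eigenvector_def)
  obtain e where e: "bij_betw e ?K B"
    using orthonormal_set_enumeration[OF B(1) norm_B B(3)] by blast
  have eB: "e k \<in> B" if "k \<in> ?K" for k using e that by (auto simp: bij_betw_def)
  have onb: "orthonormal_basis ?K e"
    unfolding orthonormal_basis_def
  proof (intro conjI ballI)
    fix j k assume jk: "j \<in> ?K" "k \<in> ?K"
    show "inner (e j) (e k) = (if j = k then 1 else 0)"
    proof (cases "j = k")
      case False
      then have "e j \<noteq> e k" using e jk by (auto simp: bij_betw_def inj_on_def)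
      then show ?thesis using B(1) eB[OF jk(1)] eB[OF jk(2)] False by (simp add: pairwise_def orthogonal_def)
    qed (use norm_B[OF eB[OF jk(1)]] in \<open>simp add: norm_eq_1\<close>)
  qed (use e B(3) in \<open>simp add: bij_betw_def\<close>)
  let ?J = "\<lambda>k s t \<omega>. G s t (e k) \<omega> \<noteq> e k"
  have "\<forall>k. \<exists>r. k \<in> ?K \<longrightarrow> jump_family M (?J k) r"
    using eigenvector_jump_family[OF B(2)[OF eB]] by blast
  then obtain rate where rate: "\<And>k. k \<in> ?K \<Longrightarrow> jump_family M (?J k) (rate k)"
    by metis
  define n where "n k = counting_process (?J k)" for k
  \<comment> \<open>The common independent sequence consists of the whole operator fields over the
    dyadic cells; each k merely evaluates them at its own \<open>e k\<close>.\<close>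
  have joint: "jointly_independent_increments M ?K n"
  proof (rule jointly_independent_increments_of_grid)
    show "indep_vars (\<lambda>_. field_space) (\<lambda>i. random_field (G (real i / 2 ^ m) (real (i + 1) / 2 ^ m))) {..<l}" for m l
      using G_indep[of "\<lambda>i. real i / 2 ^ m" l] by (simp add: divide_right_mono)
    show "Measurable.pred field_space (\<lambda>f. f (e k) \<noteq> e k)" for k
      by (rule measurable_compose[OF field_space_component]) measurable
    show "n k t \<in> measurable M (count_space UNIV)" if "k \<in> ?K" for k t
      unfolding n_def by (rule jump_family.N_measurable[OF rate[OF that]])
    show "AE \<omega> in M. eventually (\<lambda>m. card {i\<in>{dyadic_succ m s..<dyadic_succ m t}.
        random_field (G (real i / 2 ^ m) (real (i + 1) / 2 ^ m)) \<omega> (e k) \<noteq> e k} = n k t \<omega> - n k s \<omega>) sequentially"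
      if "k \<in> ?K" "0 \<le> s" "s \<le> t" for k s t
      using jump_family.AE_increment_eventually[OF rate[OF that(1)] that(2,3)]
      unfolding n_def grid_def random_field_def .
  qed
  have poisson: "poisson_process M (rate k) (n k)" if k: "k \<in> ?K" for k
  proof -
    interpret jump_family M "?J k" "rate k" by (rule rate[OF k])
    show ?thesis
      unfolding poisson_process_def
      using r_nonneg N_measurable N_0 N_mono N_right_continuous increment_law
        independent_increments_of_joint[OF joint k]
      by (simp add: n_def)
  qed
  have expansion: "AE \<omega> in M. ((\<lambda>k. (inner u (e k) * no_jump (n k) s t \<omega>) *\<^sub>R e k) has_sum G s t u \<omega>) ?K"
    if st: "0 \<le> s" "s \<le> t" for s t u
  proof -
    have "AE \<omega> in M. F s t \<omega> (e k) = no_jump (n k) s t \<omega> *\<^sub>R e k" if k: "k \<in> ?K" for k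
      using F_AE[OF st, of "e k"] joint_eigenvector_dichotomy[OF B(2)[OF eB[OF k]] st]
        jump_family.AE_jump_iff[OF rate[OF k] st]
      by eventually_elim (auto simp: no_jump_def n_def)
    then have "AE \<omega> in M. \<forall>k\<in>?K. F s t \<omega> (e k) = no_jump (n k) s t \<omega> *\<^sub>R e k"
      by (subst AE_ball_countable) auto
    with F_AE[OF st, of u] show ?thesis
    proof eventually_elim
      case (elim \<omega>)
      \<comment> \<open>The realization is bounded and linear, so it may be applied termwise to the
        Fourier series of u; its action on each basis vector is the no-jump indicator.\<close>
      have "((\<lambda>k. F s t \<omega> (inner u (e k) *\<^sub>R e k)) has_sum F s t \<omega> u) ?K"
        by (rule has_sum_bounded_linear[OF blinfun.bounded_linear_right orthonormal_basis_has_sum[OF onb]])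
      moreover have "F s t \<omega> (inner u (e k) *\<^sub>R e k) = (inner u (e k) * no_jump (n k) s t \<omega>) *\<^sub>R e k"
        if "k \<in> ?K" for k
        using elim(2) that by (simp add: blinfun.scaleR_right)
      ultimately show ?case
        unfolding elim(1) by (simp cong: has_sum_cong)
    qed
  qed
  show ?thesis
    using onb poisson joint expansion by blast
qed

end
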